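(* Let $n\ge1$, let $M,C,K$ be symmetric real $n\times n$ matrices with $M$ and $K$ positive definite, and put $\bar C=M^{-1}C$, $\bar K=M^{-1}K$, $\bar f=M^{-1}f$. Let $0<\bar T<\infty$, $I=(0,\bar T)$, $x_0,x_{\bar T}\in\mathbb{R}^n$, and $v_{0,\bar T}(t)=V_0(t)\,x_0+V_{\bar T}(t)\,x_{\bar T}$, where $V_0,V_{\bar T}:[0,\bar T]\to M_n(\mathbb{R})$ are fixed $C^\infty$ diagonal-matrix-valued mappings whose diagonal entries satisfy $(V_0)_{ii}(0)=(V_{\bar T})_{ii}(\bar T)=1$ and $(V_0)_{ii}(\bar T)=(V_{\bar T})_{ii}(0)=0$ for $1\le i\le n$. Then the equation $$-\int_0^{\bar T}\dot\varphi^{\mathrm T}e^{\bar Ct}\dot u\,dt+\int_0^{\bar T}\varphi^{\mathrm T}e^{\bar Ct}\bar K u\,dt=\int_0^{\bar T}\varphi^{\mathrm T}e^{\bar Ct}\bar f\,dt+\int_0^{\bar T}\dot\varphi^{\mathrm T}e^{\bar Ct}\dot v_{0,\bar T}\,dt-\int_0^{\bar T}\varphi^{\mathrm T}e^{\bar Ct}\bar K v_{0,\bar T}\,dt,$$ with unknown $u\in H^1_0(I,\mathbb{R}^n)$ and to be satisfied for all $\varphi\in C^\infty_0(I,\mathbb{R}^n)$, is the weak form of the multi-degree-of-freedom equation $$M\ddot x+C\dot x+Kx=f$$ with boundary conditions $x(0)=x_0$ and $x(\bar T)=x_{\bar T}$, where $x=u+v_{0,\bar T}$.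
   Context: $x:\mathbb{R}\to\mathbb{R}^n$ is the unknown displacement and $f$ is the $\mathbb{R}^n$-valued excitation. $H^1_0(I,\mathbb{R}^n)$ is the Sobolev space of $\mathbb{R}^n$-valued functions in $L^2(I)$ with weak derivative in $L^2(I)$ that vanish at $0$ and $\bar T$; $C^\infty_0(I,\mathbb{R}^n)$ is the space of smooth $\mathbb{R}^n$-valued functions with support contained in $I$. "Weak form" is used in the sense that the integral equation is equivalent to the differential equation under the relevant regularity assumption on $f$, while only first derivatives of the unknown appear in it, one derivative having been transferred to the test function by integration by parts (after multiplication of the mass-normalized equation by $e^{\bar Ct}$). *)

theory Defs
  imports "HOL-Analysis.Analysis"
begin

section \<open>Matrices\<close>

definition symmetric_matrix :: "real^'n^'n \<Rightarrow> bool" where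
  "symmetric_matrix A \<longleftrightarrow> transpose A = A"

definition positive_definite :: "real^'n^'n \<Rightarrow> bool" where
  "positive_definite A \<longleftrightarrow> (\<forall>x. x \<noteq> 0 \<longrightarrow> x \<bullet> (A *v x) > 0)"

definition diagonal_matrix :: "real^'n^'n \<Rightarrow> bool" where
  "diagonal_matrix A \<longleftrightarrow> (\<forall>i j. i \<noteq> j \<longrightarrow> A $ i $ j = 0)"

text \<open>The overloaded multiplication and power on \<open>real^'n^'n\<close> act entrywise, so the library's
  \<open>exp\<close> is not available for matrices; powers here are with respect to the matrix
  product \<open>**\<close>.\<close>

definition matrix_exp :: "real^'n^'n \<Rightarrow> real^'n^'n" where
  "matrix_exp A = (\<Sum>k. (1 / fact k) *\<^sub>R (((**) A ^^ k) (mat 1)))"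

section \<open>Smooth functions and test functions\<close>

text \<open>\<open>D k\<close> is the \<open>k\<close>-th derivative of \<open>f\<close>; it is one-sided at the end points if \<open>S\<close> is a
  closed interval.\<close>

definition smooth_on :: "real set \<Rightarrow> (real \<Rightarrow> 'a::real_normed_vector) \<Rightarrow> bool" where
  "smooth_on S f \<longleftrightarrow>
     (\<exists>D :: nat \<Rightarrow> real \<Rightarrow> 'a. (\<forall>t\<in>S. D 0 t = f t) \<and>
        (\<forall>k. \<forall>t\<in>S. (D k has_vector_derivative D (Suc k) t) (at t within S)))"

text \<open>Test functions on \<open>(0,T)\<close> are extended by zero to all of \<open>\<real>\<close>.\<close>

definition test_functions :: "real \<Rightarrow> (real \<Rightarrow> 'a::real_normed_vector) set" where
  "test_functions T = {\<phi>. smooth_on UNIV \<phi> \<and> closure {t. \<phi> t \<noteq> 0} \<subseteq> {0<..<T}}"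

section \<open>Sobolev spaces on the interval \<open>(0,T)\<close>\<close>

text \<open>Elements of the following spaces are functions on \<open>\<real>\<close> representing classes modulo equality
  almost everywhere on \<open>(0,T)\<close>; values outside \<open>(0,T)\<close> are irrelevant.\<close>

definition L2 :: "real \<Rightarrow> (real \<Rightarrow> 'a::euclidean_space) set" where
  "L2 T = {u. u \<in> borel_measurable (lebesgue_on {0<..<T}) \<and>
              integrable (lebesgue_on {0<..<T}) (\<lambda>t. (norm (u t))\<^sup>2)}"

definition has_weak_derivative ::
    "real \<Rightarrow> (real \<Rightarrow> 'a::euclidean_space) \<Rightarrow> (real \<Rightarrow> 'a) \<Rightarrow> bool" where
  "has_weak_derivative T u g \<longleftrightarrow>
     (\<forall>a b. 0 < a \<longrightarrow> a < b \<longrightarrow> b < T \<longrightarrow>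
        u absolutely_integrable_on {a..b} \<and> g absolutely_integrable_on {a..b}) \<and>
     (\<forall>\<psi> :: real \<Rightarrow> real. \<psi> \<in> test_functions T \<longrightarrow>
        (LINT t|lebesgue_on {0<..<T}. vector_derivative \<psi> (at t) *\<^sub>R u t)
        = - (LINT t|lebesgue_on {0<..<T}. \<psi> t *\<^sub>R g t))"

text \<open>A representative of the weak derivative, which is unique up to null sets.\<close>

definition weak_deriv :: "real \<Rightarrow> (real \<Rightarrow> 'a::euclidean_space) \<Rightarrow> real \<Rightarrow> 'a" where
  "weak_deriv T u = (SOME g. has_weak_derivative T u g)"

definition H1 :: "real \<Rightarrow> (real \<Rightarrow> 'a::euclidean_space) set" where
  "H1 T = {u. u \<in> L2 T \<and> (\<exists>g\<in>L2 T. has_weak_derivative T u g)}"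

definition H2 :: "real \<Rightarrow> (real \<Rightarrow> 'a::euclidean_space) set" where
  "H2 T = {u. u \<in> H1 T \<and> weak_deriv T u \<in> H1 T}"

text \<open>Boundary values are those of the continuous representative on \<open>[0,T]\<close>.\<close>

definition has_boundary_values ::
    "real \<Rightarrow> (real \<Rightarrow> 'a::euclidean_space) \<Rightarrow> 'a \<Rightarrow> 'a \<Rightarrow> bool" where
  "has_boundary_values T u a b \<longleftrightarrow>
     (\<exists>w. continuous_on {0..T} w \<and> (AE t in lebesgue_on {0<..<T}. u t = w t) \<and>
          w 0 = a \<and> w T = b)"

definition H10 :: "real \<Rightarrow> (real \<Rightarrow> 'a::euclidean_space) set" where
  "H10 T = {u. u \<in> H1 T \<and> has_boundary_values T u 0 0}"

section \<open>The boundary value problem\<close>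

definition boundary_lift ::
    "(real \<Rightarrow> real^'n^'n) \<Rightarrow> (real \<Rightarrow> real^'n^'n) \<Rightarrow> real^'n \<Rightarrow> real^'n \<Rightarrow> real \<Rightarrow> real^'n" where
  "boundary_lift V\<^sub>0 V\<^sub>T x\<^sub>0 x\<^sub>T t = V\<^sub>0 t *v x\<^sub>0 + V\<^sub>T t *v x\<^sub>T"

text \<open>The two sides of the integral equation; \<open>Cb\<close>, \<open>Kb\<close>, \<open>fb\<close> are the mass-normalized data
  \<open>M\<inverse>C\<close>, \<open>M\<inverse>K\<close>, \<open>M\<inverse>f\<close>, and \<open>v\<close> is the boundary lift.\<close>

definition weak_lhs ::
    "real \<Rightarrow> real^'n^'n \<Rightarrow> real^'n^'n \<Rightarrow> (real \<Rightarrow> real^'n) \<Rightarrow> (real \<Rightarrow> real^'n) \<Rightarrow> real" where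
  "weak_lhs T Cb Kb u \<phi> =
     - (LINT t|lebesgue_on {0<..<T}.
          vector_derivative \<phi> (at t) \<bullet> (matrix_exp (t *\<^sub>R Cb) *v weak_deriv T u t))
     + (LINT t|lebesgue_on {0<..<T}. \<phi> t \<bullet> (matrix_exp (t *\<^sub>R Cb) *v (Kb *v u t)))"

definition weak_rhs ::
    "real \<Rightarrow> real^'n^'n \<Rightarrow> real^'n^'n \<Rightarrow> (real \<Rightarrow> real^'n) \<Rightarrow> (real \<Rightarrow> real^'n) \<Rightarrow>
     (real \<Rightarrow> real^'n) \<Rightarrow> real" where
  "weak_rhs T Cb Kb fb v \<phi> =
     (LINT t|lebesgue_on {0<..<T}. \<phi> t \<bullet> (matrix_exp (t *\<^sub>R Cb) *v fb t))
     + (LINT t|lebesgue_on {0<..<T}. vector_derivative \<phi> (at t) \<bullet>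
          (matrix_exp (t *\<^sub>R Cb) *v vector_derivative v (at t within {0..T})))
     - (LINT t|lebesgue_on {0<..<T}. \<phi> t \<bullet> (matrix_exp (t *\<^sub>R Cb) *v (Kb *v v t)))"

definition weak_solution ::
    "real \<Rightarrow> real^'n^'n \<Rightarrow> real^'n^'n \<Rightarrow> (real \<Rightarrow> real^'n) \<Rightarrow> (real \<Rightarrow> real^'n) \<Rightarrow>
     (real \<Rightarrow> real^'n) \<Rightarrow> bool" where
  "weak_solution T Cb Kb fb v u \<longleftrightarrow>
     u \<in> H10 T \<and> (\<forall>\<phi>\<in>test_functions T. weak_lhs T Cb Kb u \<phi> = weak_rhs T Cb Kb fb v \<phi>)"

text \<open>Solutions for square integrable forcing (equation almost everywhere) and for
  continuous forcing (equation everywhere), respectively.\<close>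

definition strong_solution ::
    "real \<Rightarrow> real^'n^'n \<Rightarrow> real^'n^'n \<Rightarrow> real^'n^'n \<Rightarrow> (real \<Rightarrow> real^'n) \<Rightarrow>
     real^'n \<Rightarrow> real^'n \<Rightarrow> (real \<Rightarrow> real^'n) \<Rightarrow> bool" where
  "strong_solution T M C K f x\<^sub>0 x\<^sub>T x \<longleftrightarrow>
     x \<in> H2 T \<and>
     (AE t in lebesgue_on {0<..<T}.
        M *v weak_deriv T (weak_deriv T x) t + C *v weak_deriv T x t + K *v x t = f t) \<and>
     has_boundary_values T x x\<^sub>0 x\<^sub>T"

definition classical_solution ::
    "real \<Rightarrow> real^'n^'n \<Rightarrow> real^'n^'n \<Rightarrow> real^'n^'n \<Rightarrow> (real \<Rightarrow> real^'n) \<Rightarrow>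
     real^'n \<Rightarrow> real^'n \<Rightarrow> (real \<Rightarrow> real^'n) \<Rightarrow> bool" where
  "classical_solution T M C K f x\<^sub>0 x\<^sub>T x \<longleftrightarrow>
     (\<exists>x' x''. continuous_on {0..T} x'' \<and>
        (\<forall>t\<in>{0..T}. (x has_vector_derivative x' t) (at t within {0..T}) \<and>
                    (x' has_vector_derivative x'' t) (at t within {0..T}) \<and>
                    M *v x'' t + C *v x' t + K *v x t = f t)) \<and>
     x 0 = x\<^sub>0 \<and> x T = x\<^sub>T"

end

(* With E(t) = exp(t Cb) we have E (x'' + Cb x') = (E x')', so the integral equation says precisely
   that E x' has weak derivative E (fb - Kb x). Multiplying back by exp(-t Cb) shows that x' itself
   has a weak derivative, namely fb - Cb x' - Kb x, which is the strong equation. For continuous f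
   no general theory of absolutely continuous functions is needed: the boundary condition provides
   a continuous representative w of x, so E x' agrees up to a constant with the C^1 primitive of
   E (fb - Kb w), because a function with vanishing weak derivative is constant almost everywhere
   (du Bois-Reymond). *)
theory Submission
  imports Defs
begin

section \<open>Smooth functions\<close>

text \<open>Two kinds of arbitrariness shape the proof. \<open>weak_deriv\<close> picks some
  representative, known only up to null sets, so the weak, strong and classical problems are each
  compared with \<open>solves_normalized\<close>, which names the derivatives \<open>g\<close> and
  \<open>h\<close> explicitly. Likewise the Bochner integral of a non-integrable function is 0, so
  every splitting of an integral must be backed by integrability, which comes from square
  integrability or from the compact support of a test function. The integral equation tests with
  vectors and inner products, whereas \<open>has_weak_derivative\<close> tests with scalars; taking
  coordinates in one direction and multiplying by a fixed vector in the other links the two. For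
  continuous \<open>f\<close> the argument with primitives is run twice: first it yields a C^1
  representative \<open>p\<close> of x', then it shows that \<open>w\<close> itself is a primitive
  of \<open>p\<close> up to a constant. Agreement almost everywhere of continuous functions extends
  to the end points, so the boundary values survive.\<close>

text \<open>A class of functions closed under differentiation consists of smooth functions: fix one
  derivative operator on the class and iterate it. Each smoothness proof below only has to find such
  a class.\<close>

lemma smooth_on_coinduct:
  assumes "P f"
    and step: "\<And>g. P g \<Longrightarrow> \<exists>h. P h \<and> (\<forall>t\<in>S. (g has_vector_derivative h t) (at t within S))"
  shows "smooth_on S f"
proof -
  obtain d where d: "\<And>g. P g \<Longrightarrow> P (d g)"
    "\<And>g t. P g \<Longrightarrow> t \<in> S \<Longrightarrow> (g has_vector_derivative d g t) (at t within S)"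
    using step by metis
  have P: "P ((d ^^ k) f)" for k
    by (induction k) (auto intro: d assms(1))
  show ?thesis
    unfolding smooth_on_def
    by (rule exI[of _ "\<lambda>k. (d ^^ k) f"]) (use P d(2) in auto)
qed

lemma smooth_on_derivative:
  assumes "smooth_on S f"
  obtains f' where "smooth_on S f'" "\<And>t. t \<in> S \<Longrightarrow> (f has_vector_derivative f' t) (at t within S)"
proof -
  obtain D where D: "\<And>t. t \<in> S \<Longrightarrow> D 0 t = f t"
    "\<And>k t. t \<in> S \<Longrightarrow> (D k has_vector_derivative D (Suc k) t) (at t within S)"
    using assms unfolding smooth_on_def by blast
  show ?thesis
  proof
    show "smooth_on S (D 1)"
      unfolding smooth_on_def by (rule exI[of _ "\<lambda>k. D (Suc k)"]) (use D in auto)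
    show "(f has_vector_derivative D 1 t) (at t within S)" if "t \<in> S" for t
      \<comment> \<open>\<open>D 0\<close> agrees with \<open>f\<close> on \<open>S\<close> only, so
        the derivative has to be carried over within \<open>S\<close>.\<close>
      using D(2)[OF that, of 0] D(1) that
      by (auto intro: has_vector_derivative_transform[of t S f "D 0"])
  qed
qed

lemma smooth_on_primitive:
  assumes "smooth_on S f'" "\<And>t. t \<in> S \<Longrightarrow> (f has_vector_derivative f' t) (at t within S)"
  shows "smooth_on S f"
proof (rule smooth_on_coinduct[where P = "\<lambda>g. g = f \<or> smooth_on S g"])
  fix g assume "g = f \<or> smooth_on S g"
  then show "\<exists>h. (h = f \<or> smooth_on S h) \<and> (\<forall>t\<in>S. (g has_vector_derivative h t) (at t within S))"
    using assms smooth_on_derivative by metis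
qed simp

lemma smooth_on_imp_continuous_on: "smooth_on S f \<Longrightarrow> continuous_on S f"
  by (metis smooth_on_derivative continuous_on_vector_derivative)

lemma smooth_on_linear:
  assumes "bounded_linear L" "smooth_on S f"
  shows "smooth_on S (\<lambda>t. L (f t))"
proof (rule smooth_on_coinduct[where P = "\<lambda>h. \<exists>g. smooth_on S g \<and> h = (\<lambda>t. L (g t))"])
  fix h assume "\<exists>g. smooth_on S g \<and> h = (\<lambda>t. L (g t))"
  then obtain g g' where "h = (\<lambda>t. L (g t))" "smooth_on S g'"
    "\<And>t. t \<in> S \<Longrightarrow> (g has_vector_derivative g' t) (at t within S)"
    using smooth_on_derivative by metis
  then show "\<exists>h'. (\<exists>g. smooth_on S g \<and> h' = (\<lambda>t. L (g t))) \<and>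
      (\<forall>t\<in>S. (h has_vector_derivative h' t) (at t within S))"
    using bounded_linear.has_vector_derivative[OF assms(1)] by blast
qed (use assms in blast)

lemma smooth_on_add:
  assumes "smooth_on S f" "smooth_on S g"
  shows "smooth_on S (\<lambda>t. f t + g t)"
proof -
  obtain D where D: "\<forall>t\<in>S. D 0 t = f t"
    "\<forall>k. \<forall>t\<in>S. (D k has_vector_derivative D (Suc k) t) (at t within S)"
    using assms(1) unfolding smooth_on_def by blast
  obtain E where E: "\<forall>t\<in>S. E 0 t = g t"
    "\<forall>k. \<forall>t\<in>S. (E k has_vector_derivative E (Suc k) t) (at t within S)"
    using assms(2) unfolding smooth_on_def by blast
  show ?thesis
    unfolding smooth_on_def by (rule exI[of _ "\<lambda>k t. D k t + E k t"])
      (use D E in \<open>auto intro!: has_vector_derivative_add\<close>)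
qed

text \<open>The invariant for products: the Leibniz rule turns one product into a sum of two, so
  finite sums of products are closed under differentiation while single products are not.\<close>

inductive smooth_product_sum ::
    "real set \<Rightarrow> (real \<Rightarrow> 'a::real_normed_vector) \<Rightarrow> bool" for S where
  prod: "smooth_on S a \<Longrightarrow> smooth_on S f \<Longrightarrow> smooth_product_sum S (\<lambda>t. a t *\<^sub>R f t)"
| add: "smooth_product_sum S f \<Longrightarrow> smooth_product_sum S g \<Longrightarrow>
    smooth_product_sum S (\<lambda>t. f t + g t)"

lemma smooth_on_scaleR:
  assumes "smooth_on S a" "smooth_on S f"
  shows "smooth_on S (\<lambda>t. a t *\<^sub>R f t)"
proof (rule smooth_on_coinduct[where P = "smooth_product_sum S"])
  fix g :: "real \<Rightarrow> 'a" assume "smooth_product_sum S g"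
  then show "\<exists>h. smooth_product_sum S h \<and>
      (\<forall>t\<in>S. (g has_vector_derivative h t) (at t within S))"
  proof induction
    case (prod a f)
    obtain a' f' where d: "smooth_on S a'" "smooth_on S f'"
      "\<And>t. t \<in> S \<Longrightarrow> (a has_vector_derivative a' t) (at t within S)"
      "\<And>t. t \<in> S \<Longrightarrow> (f has_vector_derivative f' t) (at t within S)"
      by (metis smooth_on_derivative prod)
    show ?case
    proof (intro exI[of _ "\<lambda>t. a t *\<^sub>R f' t + a' t *\<^sub>R f t"] conjI ballI)
      show "smooth_product_sum S (\<lambda>t. a t *\<^sub>R f' t + a' t *\<^sub>R f t)"
        by (intro smooth_product_sum.intros prod d)
      show "((\<lambda>t. a t *\<^sub>R f t) has_vector_derivative a t *\<^sub>R f' t + a' t *\<^sub>R f t) (at t within S)"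
        if "t \<in> S" for t
        by (rule has_vector_derivative_scaleR)
          (use d that in \<open>auto simp: has_real_derivative_iff_has_vector_derivative\<close>)
    qed
  next
    case (add f g)
    then obtain f' g' where "smooth_product_sum S f'" "smooth_product_sum S g'"
      "\<forall>t\<in>S. (f has_vector_derivative f' t) (at t within S)"
      "\<forall>t\<in>S. (g has_vector_derivative g' t) (at t within S)"
      by blast
    then show ?case
      by (intro exI[of _ "\<lambda>t. f' t + g' t"])
        (auto intro!: has_vector_derivative_add smooth_product_sum.add)
  qed
qed (intro smooth_product_sum.prod assms)

section \<open>Bump functions built from exp(-1/x)\<close>

definition flat :: "real poly \<Rightarrow> real \<Rightarrow> real" where
  "flat p x = (if 0 < x then poly p (1 / x) * exp (- (1 / x)) else 0)"

lemma tendsto_poly_exp_minus: "((\<lambda>y::real. poly p y * exp (- y)) \<longlongrightarrow> 0) at_top"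
proof -
  have "((\<lambda>y::real. \<Sum>i\<le>degree p. coeff p i * (y ^ i / exp y)) \<longlongrightarrow> (\<Sum>i\<le>degree p. coeff p i * 0)) at_top"
    by (intro tendsto_sum tendsto_mult tendsto_const tendsto_power_div_exp_0)
  then show ?thesis
    by (simp add: poly_altdef sum_divide_distrib exp_minus divide_inverse sum_distrib_right mult.assoc)
qed

lemma tendsto_flat_0: "((\<lambda>x. flat p x) \<longlongrightarrow> 0) (at 0)"
proof -
  have "((\<lambda>x. poly p (inverse x) * exp (- inverse x)) \<longlongrightarrow> 0) (at_right 0)"
    by (rule filterlim_compose[OF tendsto_poly_exp_minus filterlim_inverse_at_top_right])
  then have "(flat p \<longlongrightarrow> 0) (at_right 0)"
    by (rule Lim_transform_eventually)
      (auto simp: eventually_at_filter flat_def inverse_eq_divide)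
  moreover have "(flat p \<longlongrightarrow> 0) (at_left 0)"
    by (rule Lim_transform_eventually[OF tendsto_const])
      (auto simp: eventually_at_filter flat_def)
  ultimately show ?thesis
    by (simp add: filterlim_at_split)
qed

text \<open>With y = 1/x the chain rule gives y^2 (p(y) - p'(y)) exp(-y); the two
  \<open>pCons 0\<close> are the factor y^2. Letting \<open>p\<close> range over all polynomials
  makes the family closed under differentiation, also at 0.\<close>

lemma has_real_derivative_flat:
  "(flat p has_real_derivative flat (pCons 0 (pCons 0 (p - pderiv p))) x) (at x)"
proof (cases x "0::real" rule: linorder_cases)
  case less
  have "((\<lambda>_. 0) has_real_derivative flat (pCons 0 (pCons 0 (p - pderiv p))) x) (at x)"
    using less by (simp add: flat_def)
  then show ?thesis
    by (rule has_field_derivative_transform_within_open[of _ _ _ "{..<0}"])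
      (use less in \<open>auto simp: flat_def\<close>)
next
  case equal
  \<comment> \<open>Dividing by y multiplies the polynomial in 1/y by its variable, so the
    difference quotient at 0 is \<open>flat (pCons 0 p)\<close>, which tends to 0.\<close>
  have "((\<lambda>y. (flat p y - flat p 0) / (y - 0)) \<longlongrightarrow> 0) (at 0)"
    by (rule Lim_transform_eventually[OF tendsto_flat_0[of "pCons 0 p"]])
      (auto simp: flat_def eventually_at_filter)
  then show ?thesis
    using equal by (simp add: has_field_derivative_iff flat_def)
next
  case greater
  have "((\<lambda>x. poly p (1 / x) * exp (- (1 / x))) has_real_derivative
      flat (pCons 0 (pCons 0 (p - pderiv p))) x) (at x)"
    using greater
    by (auto intro!: derivative_eq_intros simp: flat_def field_simps power2_eq_square)
  then show ?thesis
    by (rule has_field_derivative_transform_within_open[of _ _ _ "{0<..}"])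
      (use greater in \<open>auto simp: flat_def\<close>)
qed

lemma smooth_on_flat: "smooth_on S (\<lambda>x. flat p (s * x + c))"
proof (rule smooth_on_coinduct[where P = "\<lambda>f. \<exists>p. f = (\<lambda>x. flat p (s * x + c))"])
  fix f assume "\<exists>p. f = (\<lambda>x. flat p (s * x + c))"
  then obtain p where f: "f = (\<lambda>x. flat p (s * x + c))" by blast
  \<comment> \<open>The inner slope \<open>s\<close> produced by the chain rule is absorbed into the
    polynomial.\<close>
  define q where "q = smult s (pCons 0 (pCons 0 (p - pderiv p)))"
  have "(f has_real_derivative flat q (s * t + c)) (at t within S)" for t
  proof -
    have "((\<lambda>x. flat p (s * x + c)) has_real_derivative
        flat (pCons 0 (pCons 0 (p - pderiv p))) (s * t + c) * s) (at t within S)"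
      by (rule DERIV_chain2[OF has_real_derivative_flat]) (auto intro!: derivative_eq_intros)
    moreover have "flat (pCons 0 (pCons 0 (p - pderiv p))) (s * t + c) * s = flat q (s * t + c)"
      by (simp add: flat_def q_def algebra_simps)
    ultimately show ?thesis by (simp add: f)
  qed
  then show "\<exists>h. (\<exists>p. h = (\<lambda>x. flat p (s * x + c))) \<and>
      (\<forall>t\<in>S. (f has_vector_derivative h t) (at t within S))"
    by (intro exI[of _ "\<lambda>t. flat q (s * t + c)"])
      (auto simp: has_real_derivative_iff_has_vector_derivative)
qed blast

text \<open>As k grows, exp(-1/((k+1) d)) rises to 1 for every d > 0 while the zero set stays fixed,
  so these smooth functions approximate the indicator of (a,b) from below.\<close>

definition bump :: "real \<Rightarrow> real \<Rightarrow> nat \<Rightarrow> real \<Rightarrow> real" where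
  "bump a b k t = flat 1 (real (Suc k) * (t - a)) * flat 1 (real (Suc k) * (b - t))"

lemma smooth_on_bump: "smooth_on S (bump a b k)"
proof -
  have "smooth_on S (\<lambda>t. flat 1 (real (Suc k) * t + - (real (Suc k) * a)) *\<^sub>R
      flat 1 ((- real (Suc k)) * t + real (Suc k) * b))"
    by (intro smooth_on_scaleR smooth_on_flat)
  then show ?thesis
    by (rule back_subst[of "smooth_on S"]) (simp add: bump_def fun_eq_iff algebra_simps)
qed

lemma bump_bounds: "0 \<le> bump a b k t" "bump a b k t \<le> 1"
proof -
  have "0 \<le> flat 1 x \<and> flat 1 x \<le> 1" for x by (auto simp: flat_def)
  then show "0 \<le> bump a b k t" "bump a b k t \<le> 1"
    unfolding bump_def by (auto intro: mult_le_one)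
qed

lemma bump_pos_iff: "0 < bump a b k t \<longleftrightarrow> a < t \<and> t < b"
  by (auto simp: bump_def flat_def zero_less_mult_iff)

lemma bump_eq_0: "\<not> (a < t \<and> t < b) \<Longrightarrow> bump a b k t = 0"
  using bump_pos_iff[of a b k t] bump_bounds(1)[of a b k t] by linarith

lemma tendsto_bump: "(\<lambda>k. bump a b k t) \<longlonglongrightarrow> indicator {a<..<b} t"
proof (cases "a < t \<and> t < b")
  case True
  have *: "(\<lambda>k. flat 1 (real (Suc k) * d)) \<longlonglongrightarrow> 1" if "0 < d" for d
  proof -
    have "(\<lambda>k. exp (- (inverse (real (Suc k)) * (1 / d)))) \<longlonglongrightarrow> exp (- (0 * (1 / d)))"
      by (intro tendsto_intros LIMSEQ_inverse_real_of_nat)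
    moreover have "flat 1 (real (Suc k) * d) = exp (- (inverse (real (Suc k)) * (1 / d)))" for k
    proof -
      have "0 < real (Suc k) * d" using that by (intro mult_pos_pos) auto
      then show ?thesis by (simp add: flat_def divide_inverse)
    qed
    ultimately show ?thesis by simp
  qed
  have "(\<lambda>k. bump a b k t) \<longlonglongrightarrow> 1 * 1"
    unfolding bump_def using True by (intro tendsto_mult *) auto
  then show ?thesis using True by simp
next
  case False
  then show ?thesis by (auto simp: bump_eq_0 indicator_def)
qed

section \<open>Test functions\<close>

text \<open>Trades the condition on the closed support for a compact interval inside (0,T), the form
  in which integrability and primitives can use it.\<close>

lemma test_functions_iff:
  fixes \<phi> :: "real \<Rightarrow> 'a::real_normed_vector"
  assumes "0 < T"
  shows "\<phi> \<in> test_functions T \<longleftrightarrow>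
    smooth_on UNIV \<phi> \<and> (\<exists>a b. 0 < a \<and> a < b \<and> b < T \<and> (\<forall>t. t \<notin> {a..b} \<longrightarrow> \<phi> t = 0))"
proof -
  define S where "S = closure {t. \<phi> t \<noteq> 0}"
  have 1: "\<exists>a b. 0 < a \<and> a < b \<and> b < T \<and> (\<forall>t. t \<notin> {a..b} \<longrightarrow> \<phi> t = 0)" if sub: "S \<subseteq> {0<..<T}"
  proof (cases "S = {}")
    case True
    then have "\<phi> t = 0" for t unfolding S_def by simp
    \<comment> \<open>For the zero function any interior interval serves.\<close>
    then show ?thesis
      using assms by (intro exI[of _ "T/3"] exI[of _ "T/2"]) auto
  next
    case False
    have "bounded {0<..<T}" by simp
    then have "bounded S" using sub bounded_subset by blast
    then have "compact S" unfolding S_def compact_eq_bounded_closed by simp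
    then obtain l u where lu: "l \<in> S" "u \<in> S" "\<And>t. t \<in> S \<Longrightarrow> l \<le> t \<and> t \<le> u"
      using compact_attains_inf[OF _ False] compact_attains_sup[OF _ False] by blast
    \<comment> \<open>The bounds are halfway between the extreme points of the support and the ends
      0 and T, hence strictly inside and distinct even if \<open>l = u\<close>.\<close>
    have "\<phi> t = 0" if "t \<notin> {l/2..(u+T)/2}" for t
    proof (rule ccontr)
      assume "\<phi> t \<noteq> 0"
      then have "t \<in> S" unfolding S_def using closure_subset[of "{t. \<phi> t \<noteq> 0}"] by auto
      then have "l \<le> t" "t \<le> u" "0 < l" "u < T" using lu sub by auto
      with that show False by simp
    qed
    moreover have "0 < l" "l \<le> u" "u < T" using lu sub by auto
    ultimately show ?thesis
      by (intro exI[of _ "l/2"] exI[of _ "(u+T)/2"]) (auto intro!: less_imp_le)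
  qed
  have 2: "S \<subseteq> {0<..<T}" if "0 < a" "b < T" "\<And>t. t \<notin> {a..b} \<Longrightarrow> \<phi> t = 0" for a b
  proof -
    have "S \<subseteq> {a..b}"
      unfolding S_def by (rule closure_minimal) (use that(3) in \<open>auto simp del: atLeastAtMost_iff\<close>)
    with that show ?thesis by auto
  qed
  have "S \<subseteq> {0<..<T} \<longleftrightarrow>
      (\<exists>a b. 0 < a \<and> a < b \<and> b < T \<and> (\<forall>t. t \<notin> {a..b} \<longrightarrow> \<phi> t = 0))"
  proof
    assume "\<exists>a b. 0 < a \<and> a < b \<and> b < T \<and> (\<forall>t. t \<notin> {a..b} \<longrightarrow> \<phi> t = 0)"
    then obtain a b where "0 < a" "b < T" "\<And>t. t \<notin> {a..b} \<Longrightarrow> \<phi> t = 0" by blast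
    then show "S \<subseteq> {0<..<T}" by (rule 2)
  qed (rule 1)
  then show ?thesis
    unfolding test_functions_def mem_Collect_eq S_def[symmetric] by (rule arg_cong)
qed

lemma has_vector_derivative_smooth:
  fixes \<phi> :: "real \<Rightarrow> 'a::real_normed_vector"
  assumes "smooth_on UNIV \<phi>"
  shows "(\<phi> has_vector_derivative vector_derivative \<phi> (at t)) (at t)"
    and "smooth_on UNIV (\<lambda>t. vector_derivative \<phi> (at t))"
proof -
  obtain \<phi>' where \<phi>': "smooth_on UNIV \<phi>'" "\<And>t. (\<phi> has_vector_derivative \<phi>' t) (at t)"
    using smooth_on_derivative[OF assms] by auto
  then have "(\<lambda>t. vector_derivative \<phi> (at t)) = \<phi>'"
    using vector_derivative_at by blast
  with \<phi>' show "(\<phi> has_vector_derivative vector_derivative \<phi> (at t)) (at t)"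
    "smooth_on UNIV (\<lambda>t. vector_derivative \<phi> (at t))"
    by (simp_all add: fun_eq_iff)
qed

lemma test_function_smooth: "\<phi> \<in> test_functions T \<Longrightarrow> smooth_on UNIV \<phi>"
  by (simp add: test_functions_def)

lemma test_function_derivative:
  fixes \<phi> :: "real \<Rightarrow> 'a::real_normed_vector"
  assumes "0 < T" "\<phi> \<in> test_functions T"
  shows "(\<lambda>t. vector_derivative \<phi> (at t)) \<in> test_functions T"
proof -
  obtain a b where ab: "0 < a" "a < b" "b < T" "\<And>t. t \<notin> {a..b} \<Longrightarrow> \<phi> t = 0"
    using assms by (auto simp: test_functions_iff)
  have "vector_derivative \<phi> (at t) = 0" if "t \<notin> {a..b}" for t
  proof (rule vector_derivative_at)
    have "((\<lambda>_. 0::'a) has_vector_derivative 0) (at t)" by simp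
    then show "(\<phi> has_vector_derivative 0) (at t)"
      by (rule has_vector_derivative_transform_within_open[of _ _ _ "- {a..b}"])
        (use that ab(4) in auto)
  qed
  then show ?thesis
    using ab has_vector_derivative_smooth(2) test_function_smooth assms
    by (auto simp: test_functions_iff simp del: atLeastAtMost_iff)
qed

lemma test_functions_support_mono:
  fixes \<phi> :: "real \<Rightarrow> 'a::real_normed_vector"
  assumes "0 < T" "\<psi> \<in> test_functions T" "smooth_on UNIV \<phi>" "\<And>t. \<psi> t = 0 \<Longrightarrow> \<phi> t = 0"
  shows "\<phi> \<in> test_functions T"
  using assms unfolding test_functions_iff[OF assms(1)] by blast

lemma test_functions_scaleR:
  assumes "0 < T" "\<psi> \<in> test_functions T" "smooth_on UNIV a"
  shows "(\<lambda>t. a t *\<^sub>R \<psi> t) \<in> test_functions T"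
  using assms by (auto intro!: test_functions_support_mono[OF assms(1,2)]
      intro: smooth_on_scaleR test_function_smooth)

lemma test_functions_linear:
  assumes "0 < T" "\<phi> \<in> test_functions T" "bounded_linear L"
  shows "(\<lambda>t. L (\<phi> t)) \<in> test_functions T"
  using assms by (auto intro!: test_functions_support_mono[OF assms(1,2)]
      intro: smooth_on_linear test_function_smooth simp: linear_0 bounded_linear.linear)

lemma test_functions_add:
  fixes \<phi> \<psi> :: "real \<Rightarrow> 'a::real_normed_vector"
  assumes "0 < T" "\<phi> \<in> test_functions T" "\<psi> \<in> test_functions T"
  shows "(\<lambda>t. \<phi> t + \<psi> t) \<in> test_functions T"
proof -
  obtain a b where ab: "0 < a" "a < b" "b < T" "\<And>t. t \<notin> {a..b} \<Longrightarrow> \<phi> t = 0"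
    using assms by (auto simp: test_functions_iff)
  obtain c d where cd: "0 < c" "c < d" "d < T" "\<And>t. t \<notin> {c..d} \<Longrightarrow> \<psi> t = 0"
    using assms by (auto simp: test_functions_iff)
  have "\<phi> t + \<psi> t = 0" if "t \<notin> {min a c..max b d}" for t
  proof -
    have "t \<notin> {a..b}" "t \<notin> {c..d}" using that by auto
    then show ?thesis using ab(4) cd(4) by simp
  qed
  moreover have "0 < min a c" "min a c < max b d" "max b d < T"
    using ab cd by auto
  moreover have "smooth_on UNIV (\<lambda>t. \<phi> t + \<psi> t)"
    using assms by (intro smooth_on_add) (auto simp: test_functions_def)
  ultimately show ?thesis
    unfolding test_functions_iff[OF assms(1)] by blast
qed

lemma bump_in_test_functions:
  assumes "0 < a" "a < b" "b < T"
  shows "bump a b k \<in> test_functions T"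
proof -
  have "0 < T" "\<forall>t. t \<notin> {a..b} \<longrightarrow> bump a b k t = 0"
    using assms by (auto intro: bump_eq_0)
  then show ?thesis
    using assms smooth_on_bump by (simp only: test_functions_iff) blast
qed

text \<open>The primitive starting at 0 vanishes to the left of the support and equals the total
  integral to its right, so a vanishing mean is exactly what gives it compact support.\<close>

lemma test_function_primitive:
  fixes \<eta> :: "real \<Rightarrow> real"
  assumes T: "0 < T" and \<eta>: "\<eta> \<in> test_functions T" and int: "integral {0..T} \<eta> = 0"
  obtains \<psi> where "\<psi> \<in> test_functions T" "\<And>t. (\<psi> has_vector_derivative \<eta> t) (at t)"
proof -
  obtain a b where ab: "0 < a" "a < b" "b < T" "\<And>t. t \<notin> {a..b} \<Longrightarrow> \<eta> t = 0"
    using T \<eta> by (auto simp: test_functions_iff)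
  have cont: "continuous_on S \<eta>" for S
    using smooth_on_imp_continuous_on[OF test_function_smooth[OF \<eta>]] continuous_on_subset by blast
  define \<psi> where "\<psi> t = (if t \<in> {0..T} then integral {0..t} \<eta> else 0)" for t
  have zero: "\<psi> t = 0" if outside: "t \<notin> {a..b}" for t
  proof (cases "t \<in> {0..T}")
    case True
    then consider "0 \<le> t" "t < a" | "b < t" "t \<le> T"
      using outside by (cases "t < a") auto
    then have "integral {0..t} \<eta> = 0"
    proof cases
      case 1
      then have "integral {0..t} \<eta> = integral {0..t} (\<lambda>_. 0)"
        by (intro integral_cong ab(4)) auto
      then show ?thesis by simp
    next
      case 2
      then have "integral {t..T} \<eta> = integral {t..T} (\<lambda>_. 0)"
        by (intro integral_cong ab(4)) auto
      \<comment> \<open>Past \<open>b\<close> the tail contributes nothing, so the primitive has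
        already reached its total value 0.\<close>
      moreover have "integral {0..t} \<eta> + integral {t..T} \<eta> = integral {0..T} \<eta>"
        using 2 ab by (intro Henstock_Kurzweil_Integration.integral_combine integrable_continuous_real cont) auto
      ultimately show ?thesis using int by simp
    qed
    then show ?thesis by (simp add: \<psi>_def)
  qed (auto simp: \<psi>_def)
  have deriv: "(\<psi> has_vector_derivative \<eta> t) (at t)" for t
  proof (cases "t \<in> {a..b}")
    case True
    then have t: "t \<in> {0<..<T}" using ab by auto
    then have "((\<lambda>u. integral {0..u} \<eta>) has_vector_derivative \<eta> t) (at t within {0..T})"
      by (intro integral_has_vector_derivative cont) auto
    then have "((\<lambda>u. integral {0..u} \<eta>) has_vector_derivative \<eta> t) (at t)"
      using t by (simp add: at_within_Icc_at)
    then show ?thesis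
      by (rule has_vector_derivative_transform_within_open[of _ _ _ "{0<..<T}"])
        (use t in \<open>auto simp: \<psi>_def\<close>)
  next
    case False
    have "((\<lambda>_. 0::real) has_vector_derivative \<eta> t) (at t)" using False ab(4) by simp
    then show ?thesis
      by (rule has_vector_derivative_transform_within_open[of _ _ _ "- {a..b}"])
        (use False zero in auto)
  qed
  moreover have "\<psi> \<in> test_functions T"
    using smooth_on_primitive[of UNIV \<eta> \<psi>] deriv \<eta> ab zero
    unfolding test_functions_iff[OF T] by blast
  ultimately show ?thesis using that by blast
qed

section \<open>The fundamental lemma of the calculus of variations\<close>

text \<open>The integrability clause that \<open>has_weak_derivative\<close> imposes on both
  functions, isolated so that it can be propagated on its own.\<close>

definition locally_integrable :: "real \<Rightarrow> (real \<Rightarrow> 'a::euclidean_space) \<Rightarrow> bool" where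
  "locally_integrable T u \<longleftrightarrow>
     (\<forall>a b. 0 < a \<longrightarrow> a < b \<longrightarrow> b < T \<longrightarrow> u absolutely_integrable_on {a..b})"

lemma locally_integrableD:
  "locally_integrable T u \<Longrightarrow> 0 < a \<Longrightarrow> a < b \<Longrightarrow> b < T \<Longrightarrow> u absolutely_integrable_on {a..b}"
  by (simp add: locally_integrable_def)

lemma absolutely_integrable_continuous_scaleR:
  fixes g :: "real \<Rightarrow> 'a::euclidean_space"
  assumes "continuous_on {a..b} h" "g absolutely_integrable_on {a..b}"
  shows "(\<lambda>t. h t *\<^sub>R g t) absolutely_integrable_on {a..b::real}"
proof (rule absolutely_integrable_bounded_measurable_product[where h = "(*\<^sub>R)"])
  show "bilinear ((*\<^sub>R) :: real \<Rightarrow> 'a \<Rightarrow> 'a)"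
    using bounded_bilinear_scaleR by (simp add: bilinear_conv_bounded_bilinear)
  show "h \<in> borel_measurable (lebesgue_on {a..b})"
    using assms(1) by (rule continuous_imp_measurable_on_sets_lebesgue) simp
  show "bounded (h ` {a..b})"
    using assms(1) by (intro compact_imp_bounded compact_continuous_image) auto
qed (use assms in auto)

text \<open>Compact support turns local into global integrability. This licenses the linearity of
  the integral in all computations with weak derivatives.\<close>

lemma test_function_times_locally_integrable:
  fixes u :: "real \<Rightarrow> 'a::euclidean_space"
  assumes "0 < T" "\<psi> \<in> test_functions T" "locally_integrable T u"
  shows "integrable (lebesgue_on {0<..<T}) (\<lambda>t. \<psi> t *\<^sub>R u t)"
proof -
  obtain a b where ab: "0 < a" "a < b" "b < T" "\<And>t. t \<notin> {a..b} \<Longrightarrow> \<psi> t = 0"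
    using assms by (auto simp: test_functions_iff)
  have "(\<lambda>t. \<psi> t *\<^sub>R u t) absolutely_integrable_on {a..b}"
    using assms ab smooth_on_imp_continuous_on[OF test_function_smooth[OF assms(2)]]
    by (intro absolutely_integrable_continuous_scaleR locally_integrableD)
      (auto intro: continuous_on_subset)
  moreover have "(\<lambda>t. indicat_real {a..b} t *\<^sub>R (\<psi> t *\<^sub>R u t)) =
      (\<lambda>t. indicat_real {0<..<T} t *\<^sub>R (\<psi> t *\<^sub>R u t))"
  proof
    fix t show "indicat_real {a..b} t *\<^sub>R (\<psi> t *\<^sub>R u t) = indicat_real {0<..<T} t *\<^sub>R (\<psi> t *\<^sub>R u t)"
      using ab(1-3) ab(4)[of t] by (cases "t \<in> {a..b}") auto
  qed
  ultimately have "(\<lambda>t. \<psi> t *\<^sub>R u t) absolutely_integrable_on {0<..<T}"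
    by (simp add: set_integrable_def)
  then show ?thesis
    by (rule absolutely_integrable_imp_integrable) simp
qed

text \<open>Dynkin's pi-lambda argument extends the vanishing from open intervals to all Borel sets;
  integrating over the set where \<open>g\<close> is positive then forces that set to be
  null.\<close>

lemma AE_nonpos_if_integral_interval_zero:
  fixes g :: "real \<Rightarrow> real"
  assumes g: "integrable lebesgue g"
    and interval: "\<And>c d. (LINT t:{c<..<d}|lebesgue. g t) = 0"
    and total: "(LINT t|lebesgue. g t) = 0"
  shows "AE t in lebesgue. g t \<le> 0"
proof -
  have gA: "set_integrable lebesgue A g" if "A \<in> sets borel" for A
    unfolding set_integrable_def
    using that g by (intro integrable_mult_indicator) (auto intro: sets_completionI_sets)
  have zero: "(LINT t:A|lebesgue. g t) = 0" if "A \<in> sets borel" for A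
  proof -
    let ?G = "range (\<lambda>(c, d). {c<..<d::real})"
    have borel: "sets borel = sigma_sets UNIV ?G"
      using arg_cong[OF borel_eq_box[where 'a=real], of sets] by (simp add: case_prod_beta')
    have "Int_stable ?G"
    proof (rule Int_stableI)
      fix A B assume "A \<in> ?G" "B \<in> ?G"
      then obtain a b c d where AB: "A = {a<..<b}" "B = {c<..<d}" by auto
      \<comment> \<open>This also covers disjoint intervals: the result is then empty but still of
        the required form.\<close>
      then have "A \<inter> B = {max a c<..<min b d}" by auto
      then show "A \<inter> B \<in> ?G"
        using rangeI[of "\<lambda>(c, d). {c<..<d}" "(max a c, min b d)"] by simp
    qed
    moreover have "?G \<subseteq> Pow UNIV" by simp
    moreover have "A \<in> sigma_sets UNIV ?G" using that borel by simp
    ultimately show ?thesis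
    proof (induction rule: sigma_sets_induct_disjoint)
      case (basic A)
      then show ?case using interval by auto
    next
      case empty
      then show ?case by (simp add: set_lebesgue_integral_def)
    next
      case (compl A)
      then have A: "A \<in> sets borel" using borel by simp
      \<comment> \<open>The whole line is not among the bounded generators, so its integral enters
        through the hypothesis \<open>total\<close>.\<close>
      have "(LINT t:UNIV - A|lebesgue. g t) + (LINT t:A|lebesgue. g t) = (LINT t:UNIV|lebesgue. g t)"
        using A by (subst set_integral_Un[symmetric]) (auto intro: gA)
      then show ?case using compl total by (simp add: set_lebesgue_integral_def)
    next
      case (union A)
      then have "A i \<in> sets borel" for i using borel by auto
      moreover have "A i \<inter> A j = {}" if "i \<noteq> j" for i j
        using union(1) that by (auto simp: disjoint_family_on_def)
      ultimately have "(LINT t:(\<Union>i. A i)|lebesgue. g t) = (\<Sum>i. (LINT t:A i|lebesgue. g t))"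
        by (intro lebesgue_integral_countable_add) (auto intro: gA sets_completionI_sets)
      then show ?case using union by simp
    qed
  qed
  \<comment> \<open>\<open>g\<close> is only Lebesgue measurable; a Borel version \<open>h\<close>
    makes the set of positivity Borel.\<close>
  obtain h where h: "h \<in> borel_measurable lborel" "AE t in lborel. g t = h t"
    using completion_ex_borel_measurable_real[of g lborel] borel_measurable_integrable[OF g] by blast
  have gh: "AE t in lebesgue. g t = h t" using h(2) by (rule AE_completion)
  let ?A = "{t. 0 < h t}"
  have A: "?A \<in> sets borel" using h(1) by simp
  have "AE t in lebesgue. 0 \<le> indicator ?A t *\<^sub>R g t"
    using gh by eventually_elim (auto simp: indicator_def)
  then have "AE t in lebesgue. indicator ?A t *\<^sub>R g t = 0"
    using integral_nonneg_eq_0_iff_AE[of lebesgue "\<lambda>t. indicator ?A t *\<^sub>R g t"] zero[OF A] gA[OF A]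
    by (simp add: set_lebesgue_integral_def set_integrable_def)
  with gh show ?thesis
    by eventually_elim (auto simp: indicator_def split: if_splits)
qed

text \<open>The scalar bound, applied to the components along \<open>b\<close> and
  \<open>- b\<close>, makes every coordinate vanish almost everywhere.\<close>

lemma AE_zero_if_integral_interval_zero:
  fixes g :: "real \<Rightarrow> 'a::euclidean_space"
  assumes g: "integrable lebesgue g"
    and interval: "\<And>c d. (LINT t:{c<..<d}|lebesgue. g t) = 0"
    and total: "(LINT t|lebesgue. g t) = 0"
  shows "AE t in lebesgue. g t = 0"
proof -
  have nonpos: "AE t in lebesgue. g t \<bullet> b \<le> 0" for b
  proof (rule AE_nonpos_if_integral_interval_zero)
    fix c d
    have "set_integrable lebesgue {c<..<d} g"
      unfolding set_integrable_def using g by (intro integrable_mult_indicator) auto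
    then have "(LINT t|lebesgue. (indicat_real {c<..<d} t *\<^sub>R g t) \<bullet> b) =
        (LINT t|lebesgue. indicat_real {c<..<d} t *\<^sub>R g t) \<bullet> b"
      unfolding set_integrable_def by (intro integral_inner_left)
    then show "(LINT t:{c<..<d}|lebesgue. g t \<bullet> b) = 0"
      using interval[of c d] by (simp add: set_lebesgue_integral_def)
  qed (use g total in auto)
  have "AE t in lebesgue. g t \<bullet> b = 0" for b
    using nonpos[of b] nonpos[of "- b"] by eventually_elim simp
  then have "AE t in lebesgue. \<forall>b\<in>Basis. g t \<bullet> b = 0"
    by (intro AE_finite_allI) auto
  then show ?thesis
    by eventually_elim (rule euclidean_eqI, simp)
qed

text \<open>Bumps converge boundedly to indicators, so dominated convergence makes all integrals
  over interior intervals vanish. Since \<open>g\<close> may fail to be integrable up to 0 and T,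
  the conclusion is drawn on smaller intervals that exhaust (0,T).\<close>

lemma AE_zero_if_integral_test_function_zero:
  fixes g :: "real \<Rightarrow> 'a::euclidean_space"
  assumes T: "0 < T" and g: "locally_integrable T g"
    and zero: "\<And>\<psi>. \<psi> \<in> test_functions T \<Longrightarrow> (LINT t|lebesgue_on {0<..<T}. \<psi> t *\<^sub>R g t) = 0"
  shows "AE t in lebesgue_on {0<..<T}. g t = 0"
proof -
  have gcd: "set_integrable lebesgue {c<..<d} g" if "0 < c" "d < T" for c d
  proof (cases "c < d")
    case True
    then show ?thesis
      using locally_integrableD[OF g] that by (auto intro: set_integrable_subset[of _ "{c..d}"])
  qed (simp add: set_integrable_def)
  have interval: "(LINT t:{c<..<d}|lebesgue. g t) = 0" if cd: "0 < c" "d < T" for c d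
  proof (cases "c < d")
    case True
    \<comment> \<open>The bump vanishes outside (c,d), so \<open>g\<close> may be cut off there; the
      cut-off function is integrable on the whole line and its norm dominates the sequence.\<close>
    have eq: "bump c d k t *\<^sub>R g t = bump c d k t *\<^sub>R (indicat_real {c<..<d} t *\<^sub>R g t)" for k t
      by (cases "t \<in> {c<..<d}") (auto simp: bump_eq_0)
    have int: "integrable lebesgue (\<lambda>t. indicat_real {c<..<d} t *\<^sub>R g t)"
      using gcd[OF cd] by (simp add: set_integrable_def)
    have bump_measurable: "bump c d k \<in> borel_measurable lebesgue" for k
      using smooth_on_imp_continuous_on[OF smooth_on_bump, of UNIV c d k]
        continuous_imp_measurable_on_sets_lebesgue[of UNIV "bump c d k"]
      by (simp add: lebesgue_on_UNIV_eq)
    have "(\<lambda>k. LINT t|lebesgue. bump c d k t *\<^sub>R (indicat_real {c<..<d} t *\<^sub>R g t))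
        \<longlonglongrightarrow> (LINT t|lebesgue. indicat_real {c<..<d} t *\<^sub>R g t)"
    proof (rule integral_dominated_convergence)
      show "(\<lambda>t. indicat_real {c<..<d} t *\<^sub>R g t) \<in> borel_measurable lebesgue"
        using int by (rule borel_measurable_integrable)
      then show "(\<lambda>t. bump c d k t *\<^sub>R (indicat_real {c<..<d} t *\<^sub>R g t)) \<in> borel_measurable lebesgue" for k
        using bump_measurable by (rule borel_measurable_scaleR[rotated])
      show "integrable lebesgue (\<lambda>t. norm (indicat_real {c<..<d} t *\<^sub>R g t))"
        using int by (rule integrable_norm)
      have "(\<lambda>k. bump c d k t *\<^sub>R (indicat_real {c<..<d} t *\<^sub>R g t))
          \<longlonglongrightarrow> indicat_real {c<..<d} t *\<^sub>R g t" for t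
      proof -
        have "indicat_real {c<..<d} t *\<^sub>R (indicat_real {c<..<d} t *\<^sub>R g t) =
            indicat_real {c<..<d} t *\<^sub>R g t"
          by (simp add: indicator_def)
        then show ?thesis
          using tendsto_scaleR[OF tendsto_bump[of c d t] tendsto_const] by metis
      qed
      then show "AE t in lebesgue. (\<lambda>k. bump c d k t *\<^sub>R (indicat_real {c<..<d} t *\<^sub>R g t))
          \<longlonglongrightarrow> indicat_real {c<..<d} t *\<^sub>R g t"
        by (rule AE_I2)
      show "AE t in lebesgue. norm (bump c d k t *\<^sub>R (indicat_real {c<..<d} t *\<^sub>R g t))
          \<le> norm (indicat_real {c<..<d} t *\<^sub>R g t)" for k
        using bump_bounds[of c d k] by (intro AE_I2) (auto simp: mult.assoc intro!: mult_left_le_one_le)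
    qed
    moreover have "(LINT t|lebesgue. bump c d k t *\<^sub>R (indicat_real {c<..<d} t *\<^sub>R g t)) = 0" for k
    proof -
      have "indicat_real {0<..<T} t *\<^sub>R (bump c d k t *\<^sub>R g t) =
          bump c d k t *\<^sub>R (indicat_real {c<..<d} t *\<^sub>R g t)" for t
        using cd by (cases "t \<in> {c<..<d}") (auto simp: bump_eq_0)
      then have "(LINT t|lebesgue. bump c d k t *\<^sub>R (indicat_real {c<..<d} t *\<^sub>R g t)) =
          (LINT t|lebesgue_on {0<..<T}. bump c d k t *\<^sub>R g t)"
        by (subst integral_restrict_space) (auto simp del: scaleR_scaleR)
      also have "\<dots> = 0"
        using cd True by (intro zero bump_in_test_functions)
      finally show ?thesis .
    qed
    ultimately show ?thesis
      by (simp add: set_lebesgue_integral_def LIMSEQ_const_iff)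
  qed (simp add: set_lebesgue_integral_def)
  have "AE t in lebesgue. t \<in> {a<..<b} \<longrightarrow> g t = 0" if ab: "0 < a" "b < T" for a b
  proof -
    have "AE t in lebesgue. indicat_real {a<..<b} t *\<^sub>R g t = 0"
    proof (rule AE_zero_if_integral_interval_zero)
      show "integrable lebesgue (\<lambda>t. indicat_real {a<..<b} t *\<^sub>R g t)"
        using gcd[OF ab] by (simp add: set_integrable_def)
      show "(LINT t|lebesgue. indicat_real {a<..<b} t *\<^sub>R g t) = 0"
        using interval[OF ab] by (simp add: set_lebesgue_integral_def)
      show "(LINT t:{c<..<d}|lebesgue. indicat_real {a<..<b} t *\<^sub>R g t) = 0" for c d
      proof -
        \<comment> \<open>Cutting twice is cutting to the intersection, again an interval to which
          \<open>interval\<close> applies.\<close>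
        have "indicat_real {c<..<d} t *\<^sub>R (indicat_real {a<..<b} t *\<^sub>R g t) =
            indicat_real {max c a<..<min d b} t *\<^sub>R g t" for t
          by (auto simp: indicator_def)
        then show ?thesis
          using interval[of "max c a" "min d b"] ab
          by (simp add: set_lebesgue_integral_def del: scaleR_scaleR)
      qed
    qed
    then show ?thesis by eventually_elim (auto simp: indicator_def)
  qed
  \<comment> \<open>Countably many null sets suffice: these intervals exhaust (0,T).\<close>
  then have "AE t in lebesgue. \<forall>n. t \<in> {1 / real (Suc n)<..<T - 1 / real (Suc n)} \<longrightarrow> g t = 0"
    unfolding AE_all_countable by simp
  then have "AE t in lebesgue. t \<in> {0<..<T} \<longrightarrow> g t = 0"
  proof eventually_elim
    case (elim t)
    show ?case
    proof
      assume t: "t \<in> {0<..<T}"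
      then obtain n where "inverse (real (Suc n)) < min t (T - t)"
        using reals_Archimedean[of "min t (T - t)"] by auto
      with t have "t \<in> {1 / real (Suc n)<..<T - 1 / real (Suc n)}"
        by (simp add: inverse_eq_divide)
      with elim show "g t = 0" by blast
    qed
  qed
  then show ?thesis
    by (subst AE_restrict_space_iff) auto
qed

text \<open>Weak derivatives and the integral equation use Lebesgue integrals over the open
  interval, the fundamental theorem of calculus uses gauge integrals over the closed one; this joins
  the two.\<close>

lemma integral_lebesgue_on_greaterThanLessThan:
  fixes f :: "real \<Rightarrow> 'a::euclidean_space"
  assumes "continuous_on {0..T} f"
  shows "integrable (lebesgue_on {0<..<T}) f"
    and "(LINT t|lebesgue_on {0<..<T}. f t) = integral {0..T} f"
proof -
  have "f absolutely_integrable_on {0..T}"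
    using assms by (rule absolutely_integrable_continuous_real)
  then have "f absolutely_integrable_on {0<..<T}"
    by (rule set_integrable_subset) auto
  then show int: "integrable (lebesgue_on {0<..<T}) f"
    by (rule absolutely_integrable_imp_integrable) simp
  show "(LINT t|lebesgue_on {0<..<T}. f t) = integral {0..T} f"
    using lebesgue_integral_eq_integral[OF int] integral_open_interval_real[of 0 T f] by simp
qed

lemma test_function_continuous_on: "\<psi> \<in> test_functions T \<Longrightarrow> continuous_on S \<psi>"
  using smooth_on_imp_continuous_on test_function_smooth continuous_on_subset by blast

lemma locally_integrable_diff:
  assumes "locally_integrable T f" "locally_integrable T g"
  shows "locally_integrable T (\<lambda>t. f t - g t)"
  using assms by (simp add: locally_integrable_def set_integral_diff)

lemma locally_integrable_continuous:
  assumes "continuous_on {0..T} f" shows "locally_integrable T f"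
  unfolding locally_integrable_def
  using assms by (auto intro!: absolutely_integrable_continuous_real intro: continuous_on_subset)

text \<open>Subtracting a multiple of a fixed bump \<rho> from a test function \<eta> makes its mean
  0 and hence makes it the derivative of a test function. This reduces the claim to the fundamental
  lemma for \<open>u t - c\<close>.\<close>

lemma AE_const_if_integral_test_function_derivative_zero:
  fixes u :: "real \<Rightarrow> 'a::euclidean_space"
  assumes T: "0 < T" and u: "locally_integrable T u"
    and zero: "\<And>\<psi>. \<psi> \<in> test_functions T \<Longrightarrow>
      (LINT t|lebesgue_on {0<..<T}. vector_derivative \<psi> (at t) *\<^sub>R u t) = 0"
  obtains c where "AE t in lebesgue_on {0<..<T}. u t = c"
proof -
  define \<rho> where "\<rho> = bump (T/3) (T/2) 0"
  have \<rho>: "\<rho> \<in> test_functions T"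
    unfolding \<rho>_def using T by (intro bump_in_test_functions) auto
  define J where "J = integral {0..T} \<rho>"
  have "integral {0..T} \<rho> = 0 \<longleftrightarrow> (\<forall>t\<in>{0..T}. \<rho> t = 0)"
    using T bump_bounds(1) by (intro integral_eq_0_iff test_function_continuous_on[OF \<rho>]) (auto simp: \<rho>_def)
  \<comment> \<open>2T/5 lies strictly between T/3 and T/2, where the bump is positive.\<close>
  moreover have "\<rho> (2 * T / 5) > 0" "2 * T / 5 \<in> {0..T}"
    unfolding \<rho>_def bump_pos_iff using T by auto
  ultimately have J: "J \<noteq> 0" unfolding J_def by force
  \<comment> \<open>The only possible value: if \<open>u\<close> equals c almost everywhere, testing
    with \<rho> gives J c.\<close>
  define c where "c = (1 / J) *\<^sub>R (LINT t|lebesgue_on {0<..<T}. \<rho> t *\<^sub>R u t)"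
  have "AE t in lebesgue_on {0<..<T}. u t - c = 0"
  proof (rule AE_zero_if_integral_test_function_zero[OF T])
    show "locally_integrable T (\<lambda>t. u t - c)"
      by (intro locally_integrable_diff u locally_integrable_continuous continuous_on_const)
    fix \<eta> :: "real \<Rightarrow> real" assume \<eta>: "\<eta> \<in> test_functions T"
    define I where "I = integral {0..T} \<eta>"
    have "(\<lambda>t. \<eta> t + (- (I / J)) *\<^sub>R \<rho> t) \<in> test_functions T"
      by (rule test_functions_add[OF T \<eta>
            test_functions_linear[OF T \<rho> bounded_linear_scaleR_right]])
    moreover have "((\<lambda>t. \<eta> t + (- (I / J)) *\<^sub>R \<rho> t) has_integral I + (- (I / J)) *\<^sub>R J) {0..T}"
      unfolding I_def J_def
      by (intro has_integral_add has_integral_cmul integrable_integral integrable_continuous_real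
          test_function_continuous_on[OF \<eta>] test_function_continuous_on[OF \<rho>])
    then have "integral {0..T} (\<lambda>t. \<eta> t + (- (I / J)) *\<^sub>R \<rho> t) = 0"
      using J by (simp add: integral_unique)
    ultimately obtain \<psi> where \<psi>: "\<psi> \<in> test_functions T"
      "\<And>t. (\<psi> has_vector_derivative \<eta> t + (- (I / J)) *\<^sub>R \<rho> t) (at t)"
      using test_function_primitive[OF T] by blast
    note int = test_function_times_locally_integrable[OF T \<eta> u]
      test_function_times_locally_integrable[OF T \<rho> u]
    have "0 = (LINT t|lebesgue_on {0<..<T}. (\<eta> t + (- (I / J)) *\<^sub>R \<rho> t) *\<^sub>R u t)"
      using zero[OF \<psi>(1)] vector_derivative_at[OF \<psi>(2)] by simp
    also have "\<dots> = (LINT t|lebesgue_on {0<..<T}. \<eta> t *\<^sub>R u t - (I / J) *\<^sub>R (\<rho> t *\<^sub>R u t))"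
      by (simp add: scaleR_left_distrib scaleR_left_diff_distrib)
    also have "\<dots> = (LINT t|lebesgue_on {0<..<T}. \<eta> t *\<^sub>R u t) - I *\<^sub>R c"
      using int by (simp del: scaleR_scaleR) (simp add: c_def)
    also have "I *\<^sub>R c = (LINT t|lebesgue_on {0<..<T}. \<eta> t *\<^sub>R c)"
      using integral_lebesgue_on_greaterThanLessThan[OF test_function_continuous_on[OF \<eta>]]
      by (simp add: I_def)
    also have "(LINT t|lebesgue_on {0<..<T}. \<eta> t *\<^sub>R u t) - \<dots> =
        (LINT t|lebesgue_on {0<..<T}. \<eta> t *\<^sub>R (u t - c))"
      using int integral_lebesgue_on_greaterThanLessThan(1)[OF test_function_continuous_on[OF \<eta>]]
      by (simp add: scaleR_diff_right)
    finally show "(LINT t|lebesgue_on {0<..<T}. \<eta> t *\<^sub>R (u t - c)) = 0" by simp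
  qed
  then have "AE t in lebesgue_on {0<..<T}. u t = c" by simp
  then show ?thesis by (rule that)
qed

section \<open>Weak derivatives\<close>

lemma has_weak_derivative_iff:
  fixes u g :: "real \<Rightarrow> 'a::euclidean_space"
  shows "has_weak_derivative T u g \<longleftrightarrow> locally_integrable T u \<and> locally_integrable T g \<and>
    (\<forall>\<psi>\<in>test_functions T.
        (LINT t|lebesgue_on {0<..<T}. vector_derivative \<psi> (at t) *\<^sub>R u t)
        = - (LINT t|lebesgue_on {0<..<T}. \<psi> t *\<^sub>R g t))"
  unfolding has_weak_derivative_def locally_integrable_def by blast

lemma has_weak_derivativeD:
  fixes u g :: "real \<Rightarrow> 'a::euclidean_space"
  assumes "has_weak_derivative T u g"
  shows "locally_integrable T u" "locally_integrable T g"
    and "\<psi> \<in> test_functions T \<Longrightarrow>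
      (LINT t|lebesgue_on {0<..<T}. vector_derivative \<psi> (at t) *\<^sub>R u t)
      = - (LINT t|lebesgue_on {0<..<T}. \<psi> t *\<^sub>R g t)"
  using assms by (auto simp: has_weak_derivative_iff)

lemma locally_integrable_add:
  assumes "locally_integrable T f" "locally_integrable T g"
  shows "locally_integrable T (\<lambda>t. f t + g t)"
  using assms by (simp add: locally_integrable_def set_integral_add)

lemma locally_integrable_linear:
  assumes "locally_integrable T f" "bounded_linear L"
  shows "locally_integrable T (\<lambda>t. L (f t))"
  unfolding locally_integrable_def
  by (intro allI impI absolutely_integrable_linear[OF _ assms(2), unfolded o_def]
      locally_integrableD[OF assms(1)])

lemma locally_integrable_scaleR:
  fixes u :: "real \<Rightarrow> 'a::euclidean_space"
  assumes "continuous_on UNIV a" "locally_integrable T u"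
  shows "locally_integrable T (\<lambda>t. a t *\<^sub>R u t)"
  unfolding locally_integrable_def
  using assms by (auto intro!: absolutely_integrable_continuous_scaleR locally_integrableD
      intro: continuous_on_subset)

lemma locally_integrable_cong_AE:
  fixes f g :: "real \<Rightarrow> 'a::euclidean_space"
  assumes "locally_integrable T f" "AE t in lebesgue_on {0<..<T}. f t = g t"
  shows "locally_integrable T g"
proof -
  have "AE t in lebesgue. t \<in> {0<..<T} \<longrightarrow> f t = g t"
    using assms(2) by (subst (asm) AE_restrict_space_iff) auto
  then obtain N where N: "N \<in> null_sets lebesgue" "{t. \<not> (t \<in> {0<..<T} \<longrightarrow> f t = g t)} \<subseteq> N"
    by (auto simp: eventually_ae_filter)
  then have "negligible N" by (simp add: negligible_iff_null_sets)
  show ?thesis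
    unfolding locally_integrable_def
  proof (intro allI impI)
    fix a b assume ab: "0 < a" "a < b" "b < T"
    show "g absolutely_integrable_on {a..b}"
    proof (rule absolutely_integrable_spike)
      show "f absolutely_integrable_on {a..b}"
        using assms(1) ab by (rule locally_integrableD)
      show "negligible N" by fact
      show "g t = f t" if "t \<in> {a..b} - N" for t
      proof -
        have "t \<notin> {t. \<not> (t \<in> {0<..<T} \<longrightarrow> f t = g t)}" using that N(2) by blast
        then show ?thesis using that ab by auto
      qed
    qed
  qed
qed

lemma test_function_integral_cong_AE:
  fixes f g :: "real \<Rightarrow> 'a::euclidean_space"
  assumes "0 < T" "\<psi> \<in> test_functions T" "locally_integrable T f"
    "AE t in lebesgue_on {0<..<T}. f t = g t"
  shows "(LINT t|lebesgue_on {0<..<T}. \<psi> t *\<^sub>R f t) = (LINT t|lebesgue_on {0<..<T}. \<psi> t *\<^sub>R g t)"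
proof (rule integral_cong_AE)
  show "AE t in lebesgue_on {0<..<T}. \<psi> t *\<^sub>R f t = \<psi> t *\<^sub>R g t"
    using assms(4) by eventually_elim simp
qed (use assms locally_integrable_cong_AE test_function_times_locally_integrable in
    \<open>blast intro: borel_measurable_integrable\<close>)+

text \<open>Allows a change of representative on either side, in particular to and from those chosen
  by \<open>weak_deriv\<close>.\<close>

lemma has_weak_derivative_cong_AE:
  fixes u v g h :: "real \<Rightarrow> 'a::euclidean_space"
  assumes T: "0 < T" and w: "has_weak_derivative T u g"
    and uv: "AE t in lebesgue_on {0<..<T}. u t = v t"
    and gh: "AE t in lebesgue_on {0<..<T}. g t = h t"
  shows "has_weak_derivative T v h"
  unfolding has_weak_derivative_iff
proof (intro conjI ballI)
  have loc: "locally_integrable T u" "locally_integrable T g"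
    using w by (auto simp: has_weak_derivative_iff)
  show "locally_integrable T v" "locally_integrable T h"
    using locally_integrable_cong_AE[OF loc(1) uv] locally_integrable_cong_AE[OF loc(2) gh] by auto
  fix \<psi> :: "real \<Rightarrow> real" assume \<psi>: "\<psi> \<in> test_functions T"
  then show "(LINT t|lebesgue_on {0<..<T}. vector_derivative \<psi> (at t) *\<^sub>R v t)
      = - (LINT t|lebesgue_on {0<..<T}. \<psi> t *\<^sub>R h t)"
    using w test_function_integral_cong_AE[OF T test_function_derivative[OF T \<psi>] loc(1) uv]
      test_function_integral_cong_AE[OF T \<psi> loc(2) gh]
    by (simp add: has_weak_derivative_iff)
qed

lemma has_weak_derivative_unique:
  fixes u g h :: "real \<Rightarrow> 'a::euclidean_space"
  assumes T: "0 < T" and g: "has_weak_derivative T u g" and h: "has_weak_derivative T u h"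
  shows "AE t in lebesgue_on {0<..<T}. g t = h t"
proof -
  have loc: "locally_integrable T g" "locally_integrable T h"
    using g h by (auto simp: has_weak_derivative_iff)
  have "AE t in lebesgue_on {0<..<T}. g t - h t = 0"
  proof (rule AE_zero_if_integral_test_function_zero[OF T locally_integrable_diff[OF loc]])
    fix \<psi> :: "real \<Rightarrow> real" assume \<psi>: "\<psi> \<in> test_functions T"
    have "(LINT t|lebesgue_on {0<..<T}. \<psi> t *\<^sub>R g t) = (LINT t|lebesgue_on {0<..<T}. \<psi> t *\<^sub>R h t)"
      using g h \<psi> by (simp add: has_weak_derivative_iff)
    then show "(LINT t|lebesgue_on {0<..<T}. \<psi> t *\<^sub>R (g t - h t)) = 0"
      using test_function_times_locally_integrable[OF T \<psi> loc(1)]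
        test_function_times_locally_integrable[OF T \<psi> loc(2)]
      by (simp add: scaleR_diff_right)
  qed
  then show ?thesis by simp
qed

text \<open>Once some weak derivative exists, the choice in \<open>weak_deriv\<close> is legitimate,
  and uniqueness ties it to every other one. Both orientations of the equality are kept because the
  congruence rules are applied in either direction.\<close>

lemma weak_deriv_AE_eq:
  fixes u g :: "real \<Rightarrow> 'a::euclidean_space"
  assumes "0 < T" "has_weak_derivative T u g"
  shows "has_weak_derivative T u (weak_deriv T u)"
    and "AE t in lebesgue_on {0<..<T}. weak_deriv T u t = g t"
    and "AE t in lebesgue_on {0<..<T}. g t = weak_deriv T u t"
proof -
  show "has_weak_derivative T u (weak_deriv T u)"
    unfolding weak_deriv_def using assms(2) by (rule someI[where P = "has_weak_derivative T u"])
  then show "AE t in lebesgue_on {0<..<T}. weak_deriv T u t = g t"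
    "AE t in lebesgue_on {0<..<T}. g t = weak_deriv T u t"
    using has_weak_derivative_unique assms by blast+
qed

lemma has_weak_derivative_zero_imp_AE_const:
  fixes u :: "real \<Rightarrow> 'a::euclidean_space"
  assumes "0 < T" "has_weak_derivative T u (\<lambda>_. 0)"
  obtains c where "AE t in lebesgue_on {0<..<T}. u t = c"
  using assms AE_const_if_integral_test_function_derivative_zero[of T u]
  by (auto simp: has_weak_derivative_iff)

section \<open>Linearity and product rules for weak derivatives\<close>

lemma has_weak_derivative_linear:
  fixes L :: "'a::euclidean_space \<Rightarrow> 'b::euclidean_space"
  assumes T: "0 < T" and w: "has_weak_derivative T u g" and L: "bounded_linear L"
  shows "has_weak_derivative T (\<lambda>t. L (u t)) (\<lambda>t. L (g t))"
  unfolding has_weak_derivative_iff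
proof (intro conjI ballI)
  have loc: "locally_integrable T u" "locally_integrable T g"
    using w by (auto simp: has_weak_derivative_iff)
  then show "locally_integrable T (\<lambda>t. L (u t))" "locally_integrable T (\<lambda>t. L (g t))"
    using L by (auto intro: locally_integrable_linear)
  have int: "(LINT t|lebesgue_on {0<..<T}. \<psi> t *\<^sub>R L (f t)) = L (LINT t|lebesgue_on {0<..<T}. \<psi> t *\<^sub>R f t)"
    if "\<psi> \<in> test_functions T" "locally_integrable T f" for \<psi> f
    using integral_bounded_linear[OF L test_function_times_locally_integrable[OF T that]]
    by (simp add: linear_cmul[OF bounded_linear.linear[OF L]])
  fix \<psi> :: "real \<Rightarrow> real" assume \<psi>: "\<psi> \<in> test_functions T"
  show "(LINT t|lebesgue_on {0<..<T}. vector_derivative \<psi> (at t) *\<^sub>R L (u t)) =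
      - (LINT t|lebesgue_on {0<..<T}. \<psi> t *\<^sub>R L (g t))"
    using w \<psi> loc int test_function_derivative[OF T \<psi>] linear_neg[OF bounded_linear.linear[OF L]]
    by (simp add: has_weak_derivative_iff)
qed

lemma has_weak_derivative_add:
  fixes u v g h :: "real \<Rightarrow> 'a::euclidean_space"
  assumes T: "0 < T" and w: "has_weak_derivative T u g" "has_weak_derivative T v h"
  shows "has_weak_derivative T (\<lambda>t. u t + v t) (\<lambda>t. g t + h t)"
  unfolding has_weak_derivative_iff
proof (intro conjI ballI)
  note loc = has_weak_derivativeD(1,2)[OF w(1)] has_weak_derivativeD(1,2)[OF w(2)]
  show "locally_integrable T (\<lambda>t. u t + v t)" "locally_integrable T (\<lambda>t. g t + h t)"
    using loc by (auto intro: locally_integrable_add)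
  fix \<psi> :: "real \<Rightarrow> real" assume \<psi>: "\<psi> \<in> test_functions T"
  note int = test_function_times_locally_integrable[OF T \<psi>]
    test_function_times_locally_integrable[OF T test_function_derivative[OF T \<psi>]]
  show "(LINT t|lebesgue_on {0<..<T}. vector_derivative \<psi> (at t) *\<^sub>R (u t + v t))
      = - (LINT t|lebesgue_on {0<..<T}. \<psi> t *\<^sub>R (g t + h t))"
    using has_weak_derivativeD(3)[OF w(1) \<psi>] has_weak_derivativeD(3)[OF w(2) \<psi>]
      int(2)[OF loc(1)] int(1)[OF loc(2)] int(2)[OF loc(3)] int(1)[OF loc(4)]
    by (simp add: scaleR_add_right)
qed

lemma has_weak_derivative_diff:
  fixes u v g h :: "real \<Rightarrow> 'a::euclidean_space"
  assumes T: "0 < T" and w: "has_weak_derivative T u g" "has_weak_derivative T v h"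
  shows "has_weak_derivative T (\<lambda>t. u t - v t) (\<lambda>t. g t - h t)"
  unfolding has_weak_derivative_iff
proof (intro conjI ballI)
  note loc = has_weak_derivativeD(1,2)[OF w(1)] has_weak_derivativeD(1,2)[OF w(2)]
  show "locally_integrable T (\<lambda>t. u t - v t)" "locally_integrable T (\<lambda>t. g t - h t)"
    using loc by (auto intro: locally_integrable_diff)
  fix \<psi> :: "real \<Rightarrow> real" assume \<psi>: "\<psi> \<in> test_functions T"
  note int = test_function_times_locally_integrable[OF T \<psi>]
    test_function_times_locally_integrable[OF T test_function_derivative[OF T \<psi>]]
  show "(LINT t|lebesgue_on {0<..<T}. vector_derivative \<psi> (at t) *\<^sub>R (u t - v t))
      = - (LINT t|lebesgue_on {0<..<T}. \<psi> t *\<^sub>R (g t - h t))"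
    using has_weak_derivativeD(3)[OF w(1) \<psi>] has_weak_derivativeD(3)[OF w(2) \<psi>]
      int(2)[OF loc(1)] int(1)[OF loc(2)] int(2)[OF loc(3)] int(1)[OF loc(4)]
    by (simp add: scaleR_diff_right)
qed

lemma has_weak_derivative_sum:
  fixes u g :: "'i \<Rightarrow> real \<Rightarrow> 'a::euclidean_space"
  assumes T: "0 < T" and w: "\<And>i. i \<in> I \<Longrightarrow> has_weak_derivative T (u i) (g i)"
  shows "has_weak_derivative T (\<lambda>t. \<Sum>i\<in>I. u i t) (\<lambda>t. \<Sum>i\<in>I. g i t)"
proof -
  have "has_weak_derivative T (\<lambda>_. 0::'a) (\<lambda>_. 0)"
    by (simp add: has_weak_derivative_iff locally_integrable_def)
  then show ?thesis
    \<comment> \<open>Over an infinite index set both sums are 0 by convention, so the zero function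
      settles that case as well.\<close>
    using w by (induction I rule: infinite_finite_induct) (auto intro: has_weak_derivative_add[OF T])
qed

text \<open>Test the weak derivative of \<open>u\<close> with a \<psi>, which is again a test
  function; the Leibniz term a' \<psi> then moves to the other side.\<close>

lemma has_weak_derivative_scaleR:
  fixes u g :: "real \<Rightarrow> 'a::euclidean_space"
  assumes T: "0 < T" and w: "has_weak_derivative T u g" and a: "smooth_on UNIV a"
  shows "has_weak_derivative T (\<lambda>t. a t *\<^sub>R u t)
    (\<lambda>t. vector_derivative a (at t) *\<^sub>R u t + a t *\<^sub>R g t)"
  unfolding has_weak_derivative_iff
proof (intro conjI ballI)
  let ?a' = "\<lambda>t. vector_derivative a (at t)"
  have loc: "locally_integrable T u" "locally_integrable T g"
    using w by (auto simp: has_weak_derivative_iff)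
  then have loc': "locally_integrable T (\<lambda>t. a t *\<^sub>R u t)" "locally_integrable T (\<lambda>t. ?a' t *\<^sub>R u t)"
      "locally_integrable T (\<lambda>t. a t *\<^sub>R g t)"
    using a has_vector_derivative_smooth(2)[OF a]
    by (auto intro!: locally_integrable_scaleR smooth_on_imp_continuous_on)
  then show "locally_integrable T (\<lambda>t. a t *\<^sub>R u t)"
    "locally_integrable T (\<lambda>t. ?a' t *\<^sub>R u t + a t *\<^sub>R g t)"
    by (auto intro: locally_integrable_add)
  fix \<psi> :: "real \<Rightarrow> real" assume \<psi>: "\<psi> \<in> test_functions T"
  let ?\<psi>' = "\<lambda>t. vector_derivative \<psi> (at t)"
  note int = test_function_times_locally_integrable[OF T]
  have a\<psi>: "(\<lambda>t. a t *\<^sub>R \<psi> t) \<in> test_functions T"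
    using T \<psi> a by (rule test_functions_scaleR)
  have "vector_derivative (\<lambda>t. a t *\<^sub>R \<psi> t) (at t) = a t *\<^sub>R ?\<psi>' t + ?a' t *\<^sub>R \<psi> t" for t
    using has_vector_derivative_smooth(1)[OF a, of t]
      has_vector_derivative_smooth(1)[OF test_function_smooth[OF \<psi>], of t]
    by (intro vector_derivative_at has_vector_derivative_scaleR)
      (auto simp: has_real_derivative_iff_has_vector_derivative)
  then have "(LINT t|lebesgue_on {0<..<T}. (a t *\<^sub>R ?\<psi>' t + ?a' t *\<^sub>R \<psi> t) *\<^sub>R u t) =
      - (LINT t|lebesgue_on {0<..<T}. (a t *\<^sub>R \<psi> t) *\<^sub>R g t)"
    using has_weak_derivativeD(3)[OF w a\<psi>] by (simp only:)
  then have "(LINT t|lebesgue_on {0<..<T}. ?\<psi>' t *\<^sub>R (a t *\<^sub>R u t) + \<psi> t *\<^sub>R (?a' t *\<^sub>R u t)) =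
      - (LINT t|lebesgue_on {0<..<T}. \<psi> t *\<^sub>R (a t *\<^sub>R g t))"
    by (simp add: scaleR_add_left mult.commute)
  then have "(LINT t|lebesgue_on {0<..<T}. ?\<psi>' t *\<^sub>R (a t *\<^sub>R u t)) +
      (LINT t|lebesgue_on {0<..<T}. \<psi> t *\<^sub>R (?a' t *\<^sub>R u t)) =
      - (LINT t|lebesgue_on {0<..<T}. \<psi> t *\<^sub>R (a t *\<^sub>R g t))"
    using int[OF test_function_derivative[OF T \<psi>] loc'(1)] int[OF \<psi> loc'(2)]
    by (simp del: scaleR_scaleR)
  moreover have "(LINT t|lebesgue_on {0<..<T}. \<psi> t *\<^sub>R (?a' t *\<^sub>R u t + a t *\<^sub>R g t)) =
      (LINT t|lebesgue_on {0<..<T}. \<psi> t *\<^sub>R (?a' t *\<^sub>R u t)) +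
      (LINT t|lebesgue_on {0<..<T}. \<psi> t *\<^sub>R (a t *\<^sub>R g t))"
    using int[OF \<psi> loc'(2)] int[OF \<psi> loc'(3)]
    by (simp add: scaleR_add_right del: scaleR_scaleR)
  ultimately show "(LINT t|lebesgue_on {0<..<T}. ?\<psi>' t *\<^sub>R (a t *\<^sub>R u t)) =
      - (LINT t|lebesgue_on {0<..<T}. \<psi> t *\<^sub>R (?a' t *\<^sub>R u t + a t *\<^sub>R g t))"
    by (simp only: eq_neg_iff_add_eq_0 add.assoc)
qed

text \<open>Isolates the matrix entries as scalar factors, so that the product rule for scalar
  coefficients yields the one for matrices.\<close>

lemma matrix_vector_eq_sum_axis:
  fixes A :: "real^'n^'m"
  shows "A *v x = (\<Sum>i\<in>UNIV. \<Sum>j\<in>UNIV. A $ i $ j *\<^sub>R (x $ j *\<^sub>R axis i 1))"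
proof (subst vec_eq_iff, rule allI)
  fix k
  have "(\<Sum>i\<in>UNIV. \<Sum>j\<in>UNIV. A $ i $ j *\<^sub>R (x $ j *\<^sub>R axis i 1)) $ k =
      (\<Sum>i\<in>UNIV. if i = k then \<Sum>j\<in>UNIV. A $ i $ j * x $ j else 0)"
    unfolding sum_component by (intro sum.cong refl) (auto simp: axis_def)
  then show "(A *v x) $ k = (\<Sum>i\<in>UNIV. \<Sum>j\<in>UNIV. A $ i $ j *\<^sub>R (x $ j *\<^sub>R axis i 1)) $ k"
    by (simp add: matrix_vector_mult_def)
qed

lemma has_weak_derivative_matrix_vector:
  fixes A A' :: "real \<Rightarrow> real^'n^'m" and u g :: "real \<Rightarrow> real^'n"
  assumes T: "0 < T" and w: "has_weak_derivative T u g" and A: "smooth_on UNIV A"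
    and A': "\<And>t. (A has_vector_derivative A' t) (at t)"
  shows "has_weak_derivative T (\<lambda>t. A t *v u t) (\<lambda>t. A' t *v u t + A t *v g t)"
proof -
  have nth: "bounded_linear (\<lambda>B. B $ i $ j)" for i :: 'm and j :: 'n
    by (intro bounded_linear_compose[OF bounded_linear_vec_nth] bounded_linear_vec_nth)
  have *: "has_weak_derivative T (\<lambda>t. A t $ i $ j *\<^sub>R (u t $ j *\<^sub>R axis i 1))
      (\<lambda>t. A' t $ i $ j *\<^sub>R (u t $ j *\<^sub>R axis i 1) + A t $ i $ j *\<^sub>R (g t $ j *\<^sub>R axis i (1::real)))"
    for i j
  proof -
    have "vector_derivative (\<lambda>t. A t $ i $ j) (at t) = A' t $ i $ j" for t
      by (rule vector_derivative_at[OF bounded_linear.has_vector_derivative[OF nth A']])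
    moreover have "has_weak_derivative T (\<lambda>t. u t $ j *\<^sub>R axis i (1::real)) (\<lambda>t. g t $ j *\<^sub>R axis i 1)"
      by (rule has_weak_derivative_linear[OF T w, of "\<lambda>x. x $ j *\<^sub>R axis i 1"])
        (intro bounded_linear_scaleR_const bounded_linear_vec_nth)
    ultimately show ?thesis
      using has_weak_derivative_scaleR[OF T _ smooth_on_linear[OF nth A], of _ _ i j]
      by (simp del: scaleR_scaleR)
  qed
  have "has_weak_derivative T
      (\<lambda>t. \<Sum>i\<in>UNIV. \<Sum>j\<in>UNIV. A t $ i $ j *\<^sub>R (u t $ j *\<^sub>R axis i (1::real)))
      (\<lambda>t. \<Sum>i\<in>UNIV. \<Sum>j\<in>UNIV.
          A' t $ i $ j *\<^sub>R (u t $ j *\<^sub>R axis i 1) + A t $ i $ j *\<^sub>R (g t $ j *\<^sub>R axis i 1))"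
    by (intro has_weak_derivative_sum[OF T] *)
  then show ?thesis
    by (simp only: matrix_vector_eq_sum_axis sum.distrib)
qed

section \<open>Vector-valued test functions\<close>

lemma integral_test_function_inner:
  fixes w :: "real \<Rightarrow> 'a::euclidean_space"
  assumes T: "0 < T" and \<phi>: "\<phi> \<in> test_functions T" and w: "locally_integrable T w"
  shows "integrable (lebesgue_on {0<..<T}) (\<lambda>t. \<phi> t \<bullet> w t)"
    and "(LINT t|lebesgue_on {0<..<T}. \<phi> t \<bullet> w t) =
      (\<Sum>b\<in>Basis. LINT t|lebesgue_on {0<..<T}. (\<phi> t \<bullet> b) *\<^sub>R (w t \<bullet> b))"
proof -
  have int: "integrable (lebesgue_on {0<..<T}) (\<lambda>t. (\<phi> t \<bullet> b) *\<^sub>R (w t \<bullet> b))" for b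
    using test_functions_linear[OF T \<phi> bounded_linear_inner_left]
      locally_integrable_linear[OF w bounded_linear_inner_left]
    by (rule test_function_times_locally_integrable[OF T])
  have eq: "(\<lambda>t. \<phi> t \<bullet> w t) = (\<lambda>t. \<Sum>b\<in>Basis. (\<phi> t \<bullet> b) *\<^sub>R (w t \<bullet> b))"
    unfolding real_scaleR_def by (intro ext euclidean_inner)
  show "integrable (lebesgue_on {0<..<T}) (\<lambda>t. \<phi> t \<bullet> w t)"
    unfolding eq by (intro Bochner_Integration.integrable_sum int)
  show "(LINT t|lebesgue_on {0<..<T}. \<phi> t \<bullet> w t) =
      (\<Sum>b\<in>Basis. LINT t|lebesgue_on {0<..<T}. (\<phi> t \<bullet> b) *\<^sub>R (w t \<bullet> b))"
    unfolding eq by (intro Bochner_Integration.integral_sum int)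
qed

text \<open>The bridge between the integral equation, which pairs \<phi> by inner products, and the
  scalar definition of the weak derivative.\<close>

lemma has_weak_derivative_iff_vector_test_functions:
  fixes w g :: "real \<Rightarrow> 'a::euclidean_space"
  assumes T: "0 < T" and loc: "locally_integrable T w" "locally_integrable T g"
  shows "has_weak_derivative T w g \<longleftrightarrow> (\<forall>\<phi>\<in>test_functions T.
    (LINT t|lebesgue_on {0<..<T}. vector_derivative \<phi> (at t) \<bullet> w t) =
    - (LINT t|lebesgue_on {0<..<T}. \<phi> t \<bullet> g t))" (is "?weak \<longleftrightarrow> ?vector")
proof
  assume weak: ?weak
  show ?vector
  proof
    fix \<phi> :: "real \<Rightarrow> 'a" assume \<phi>: "\<phi> \<in> test_functions T"
    \<comment> \<open>Each coordinate of \<phi> is a scalar test function, paired with the same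
      coordinate of \<open>w\<close>.\<close>
    have "(LINT t|lebesgue_on {0<..<T}. (vector_derivative \<phi> (at t) \<bullet> b) *\<^sub>R (w t \<bullet> b)) =
        - (LINT t|lebesgue_on {0<..<T}. (\<phi> t \<bullet> b) *\<^sub>R (g t \<bullet> b))" for b
    proof -
      have "vector_derivative (\<lambda>t. \<phi> t \<bullet> b) (at t) = vector_derivative \<phi> (at t) \<bullet> b" for t
        by (rule vector_derivative_at[OF bounded_linear.has_vector_derivative[OF
              bounded_linear_inner_left has_vector_derivative_smooth(1)[OF test_function_smooth[OF \<phi>]]]])
      then show ?thesis
        using has_weak_derivativeD(3)[OF
            has_weak_derivative_linear[OF T weak bounded_linear_inner_left, of b]
            test_functions_linear[OF T \<phi> bounded_linear_inner_left, of b]]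
        by simp
    qed
    then show "(LINT t|lebesgue_on {0<..<T}. vector_derivative \<phi> (at t) \<bullet> w t) =
        - (LINT t|lebesgue_on {0<..<T}. \<phi> t \<bullet> g t)"
      by (simp only: integral_test_function_inner(2)[OF T test_function_derivative[OF T \<phi>] loc(1)]
          integral_test_function_inner(2)[OF T \<phi> loc(2)] sum_negf)
  qed
next
  assume vector: ?vector
  show ?weak
    unfolding has_weak_derivative_iff
  proof (intro conjI ballI loc)
    fix \<psi> :: "real \<Rightarrow> real" assume \<psi>: "\<psi> \<in> test_functions T"
    show "(LINT t|lebesgue_on {0<..<T}. vector_derivative \<psi> (at t) *\<^sub>R w t) =
        - (LINT t|lebesgue_on {0<..<T}. \<psi> t *\<^sub>R g t)"
    proof (rule euclidean_eqI)
      fix b :: 'a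
      \<comment> \<open>A scalar test function pointing in the constant direction \<open>b\<close>
        picks out that coordinate of the identity.\<close>
      have "vector_derivative (\<lambda>t. \<psi> t *\<^sub>R b) (at t) = vector_derivative \<psi> (at t) *\<^sub>R b" for t
        by (rule vector_derivative_at[OF bounded_linear.has_vector_derivative[OF
              bounded_linear_scaleR_left has_vector_derivative_smooth(1)[OF test_function_smooth[OF \<psi>]]]])
      then have "(LINT t|lebesgue_on {0<..<T}. (vector_derivative \<psi> (at t) *\<^sub>R b) \<bullet> w t) =
          - (LINT t|lebesgue_on {0<..<T}. (\<psi> t *\<^sub>R b) \<bullet> g t)"
        using bspec[OF vector test_functions_linear[OF T \<psi> bounded_linear_scaleR_left, of b]]
        by (simp only:)
      moreover have "(LINT t|lebesgue_on {0<..<T}. \<eta> t *\<^sub>R f t) \<bullet> b =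
          (LINT t|lebesgue_on {0<..<T}. (\<eta> t *\<^sub>R b) \<bullet> f t)"
        if "\<eta> \<in> test_functions T" "locally_integrable T f" for \<eta> f
        using test_function_times_locally_integrable[OF T that]
        by (subst integral_inner_left[symmetric]) (auto simp: inner_commute)
      ultimately show "(LINT t|lebesgue_on {0<..<T}. vector_derivative \<psi> (at t) *\<^sub>R w t) \<bullet> b =
          (- (LINT t|lebesgue_on {0<..<T}. \<psi> t *\<^sub>R g t)) \<bullet> b"
        using \<psi> test_function_derivative[OF T \<psi>] loc by simp
    qed
  qed
qed

text \<open>Integration by parts, with boundary terms that vanish because \<psi> is 0 at both ends.
  One-sided derivatives at 0 and T suffice, which is all that a lift smooth on [0,T]
  provides.\<close>

lemma has_weak_derivative_C1:
  fixes w g :: "real \<Rightarrow> 'a::euclidean_space"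
  assumes T: "0 < T" and g: "continuous_on {0..T} g"
    and deriv: "\<And>t. t \<in> {0..T} \<Longrightarrow> (w has_vector_derivative g t) (at t within {0..T})"
  shows "has_weak_derivative T w g"
  unfolding has_weak_derivative_iff
proof (intro conjI ballI)
  have w: "continuous_on {0..T} w"
    using deriv by (rule continuous_on_vector_derivative)
  show loc: "locally_integrable T w" "locally_integrable T g"
    using w g by (auto intro: locally_integrable_continuous)
  fix \<psi> :: "real \<Rightarrow> real" assume \<psi>: "\<psi> \<in> test_functions T"
  let ?\<psi>' = "\<lambda>t. vector_derivative \<psi> (at t)"
  have ends: "\<psi> 0 = 0" "\<psi> T = 0"
    using T \<psi> by (auto simp: test_functions_iff)
  have cont: "continuous_on {0..T} (\<lambda>t. ?\<psi>' t *\<^sub>R w t)" "continuous_on {0..T} (\<lambda>t. \<psi> t *\<^sub>R g t)"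
    by (intro continuous_on_scaleR w g test_function_continuous_on[OF \<psi>]
        test_function_continuous_on[OF test_function_derivative[OF T \<psi>]])+
  have "((\<lambda>t. \<psi> t *\<^sub>R g t + ?\<psi>' t *\<^sub>R w t) has_integral \<psi> T *\<^sub>R w T - \<psi> 0 *\<^sub>R w 0) {0..T}"
  proof (rule fundamental_theorem_of_calculus)
    fix t assume t: "t \<in> {0..T}"
    have "(\<psi> has_vector_derivative ?\<psi>' t) (at t within {0..T})"
      using has_vector_derivative_smooth(1)[OF test_function_smooth[OF \<psi>]]
      by (rule has_vector_derivative_at_within)
    with deriv[OF t] show "((\<lambda>t. \<psi> t *\<^sub>R w t) has_vector_derivative \<psi> t *\<^sub>R g t + ?\<psi>' t *\<^sub>R w t)
        (at t within {0..T})"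
      by (intro has_vector_derivative_scaleR) (simp_all add: has_real_derivative_iff_has_vector_derivative)
  qed (use T in simp)
  then have "integral {0..T} (\<lambda>t. \<psi> t *\<^sub>R g t) + integral {0..T} (\<lambda>t. ?\<psi>' t *\<^sub>R w t) = 0"
    using cont ends
    by (subst Henstock_Kurzweil_Integration.integral_add[symmetric])
      (auto intro: integrable_continuous_real simp: integral_unique)
  then show "(LINT t|lebesgue_on {0<..<T}. ?\<psi>' t *\<^sub>R w t) =
      - (LINT t|lebesgue_on {0<..<T}. \<psi> t *\<^sub>R g t)"
    using integral_lebesgue_on_greaterThanLessThan(2)[OF cont(1)]
      integral_lebesgue_on_greaterThanLessThan(2)[OF cont(2)]
    by (simp add: eq_neg_iff_add_eq_0 add.commute)
qed

section \<open>The matrix exponential\<close>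

definition matrix_power :: "real^'n^'n \<Rightarrow> nat \<Rightarrow> real^'n^'n" where
  "matrix_power A k = ((**) A ^^ k) (mat 1)"

lemma matrix_power_simps [simp]:
  "matrix_power A 0 = mat 1" "matrix_power A (Suc k) = A ** matrix_power A k"
  by (simp_all add: matrix_power_def)

lemma matrix_power_commute: "matrix_power A k ** A = A ** matrix_power A k"
  by (induction k) (simp_all add: matrix_mul_assoc[symmetric])

text \<open>Supplies the Leibniz rule and the scaling and sign laws for \<open>**\<close>.\<close>

lemma bounded_bilinear_matrix_mult:
  "bounded_bilinear ((**) :: real^'n^'m \<Rightarrow> real^'p^'n \<Rightarrow> real^'p^'m)"
  by (auto simp: bilinear_conv_bounded_bilinear[symmetric] bilinear_def vec_eq_iff matrix_matrix_mult_def
      algebra_simps sum.distrib sum_distrib_left intro!: linearI)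

lemma matrix_power_scaleR: "matrix_power (t *\<^sub>R A) k = t ^ k *\<^sub>R matrix_power A k"
  by (induction k) (simp_all add: bounded_bilinear.scaleR_left[OF bounded_bilinear_matrix_mult]
      bounded_bilinear.scaleR_right[OF bounded_bilinear_matrix_mult])

text \<open>The sum of all absolute entries dominates each absolute row sum, so the induction step
  costs one more factor of it. The entries of the powers thus grow at most geometrically and the
  exponential series is a majorant.\<close>

lemma matrix_power_entry_bound:
  "\<bar>matrix_power A k $ i $ j\<bar> \<le> (\<Sum>i\<in>UNIV. \<Sum>j\<in>UNIV. \<bar>A $ i $ j\<bar>) ^ k"
proof (induction k arbitrary: i)
  case 0
  then show ?case by (simp add: mat_def)
next
  case (Suc k)
  let ?B = "\<Sum>i\<in>UNIV. \<Sum>j\<in>UNIV. \<bar>A $ i $ j\<bar>"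
  have "\<bar>matrix_power A (Suc k) $ i $ j\<bar> \<le> (\<Sum>l\<in>UNIV. \<bar>A $ i $ l * matrix_power A k $ l $ j\<bar>)"
    by (simp add: matrix_matrix_mult_def sum_abs)
  also have "\<dots> \<le> (\<Sum>l\<in>UNIV. \<bar>A $ i $ l\<bar> * ?B ^ k)"
    unfolding abs_mult by (intro sum_mono mult_left_mono Suc.IH) simp
  also have "\<dots> = (\<Sum>l\<in>UNIV. \<bar>A $ i $ l\<bar>) * ?B ^ k"
    by (simp add: sum_distrib_right)
  also have "\<dots> \<le> ?B * ?B ^ k"
    by (intro mult_right_mono member_le_sum[where f = "\<lambda>i. \<Sum>l\<in>UNIV. \<bar>A $ i $ l\<bar>"])
      (auto intro!: sum_nonneg zero_le_power)
  finally show ?case by simp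
qed

text \<open>The coefficients of one entry of exp(tA) as a scalar power series in t, so that termwise
  differentiation of real power series applies.\<close>

definition matrix_exp_coeff :: "real^'n^'n \<Rightarrow> 'n \<Rightarrow> 'n \<Rightarrow> nat \<Rightarrow> real" where
  "matrix_exp_coeff A i j k = matrix_power A k $ i $ j / fact k"

lemma summable_matrix_exp_coeff: "summable (\<lambda>k. matrix_exp_coeff A i j k * t ^ k)"
proof (rule summable_comparison_test')
  let ?B = "\<Sum>i\<in>UNIV. \<Sum>j\<in>UNIV. \<bar>A $ i $ j\<bar>"
  show "summable (\<lambda>k. inverse (fact k) * (?B * \<bar>t\<bar>) ^ k)"
    by (rule summable_exp)
  show "norm (matrix_exp_coeff A i j k * t ^ k) \<le> inverse (fact k) * (?B * \<bar>t\<bar>) ^ k" for k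
    using mult_right_mono[OF matrix_power_entry_bound[of A k i j], of "\<bar>t\<bar> ^ k / fact k"]
    by (simp add: matrix_exp_coeff_def abs_mult power_abs power_mult_distrib field_simps)
qed

lemma matrix_exp_entry:
  fixes A :: "real^'n^'n"
  shows "matrix_exp (t *\<^sub>R A) $ i $ j = (\<Sum>k. matrix_exp_coeff A i j k * t ^ k)"
proof -
  \<comment> \<open>The candidate sum is given entry by entry, since convergence of matrices is
    componentwise.\<close>
  define E :: "real^'n^'n" where "E = (\<chi> i j. \<Sum>k. matrix_exp_coeff A i j k * t ^ k)"
  have "(\<lambda>k. (1 / fact k) *\<^sub>R matrix_power (t *\<^sub>R A) k) sums E"
    unfolding sums_def
  proof (intro vec_tendstoI)
    fix i j
    have "(\<lambda>k. matrix_exp_coeff A i j k * t ^ k) sums (E $ i $ j)"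
      unfolding E_def by (simp, rule summable_sums[OF summable_matrix_exp_coeff])
    then show "(\<lambda>n. (\<Sum>k<n. (1 / fact k) *\<^sub>R matrix_power (t *\<^sub>R A) k) $ i $ j)
        \<longlonglongrightarrow> E $ i $ j"
      by (simp add: sums_def matrix_power_scaleR matrix_exp_coeff_def field_simps)
  qed
  then have "matrix_exp (t *\<^sub>R A) = E"
    unfolding matrix_exp_def matrix_power_def[symmetric] by (rule sums_unique[symmetric])
  then show ?thesis by (simp add: E_def)
qed

text \<open>A commutes with each of its powers, so the two entrywise series agree term by
  term.\<close>

lemma matrix_exp_commute: "matrix_exp (t *\<^sub>R A) ** A = A ** matrix_exp (t *\<^sub>R A)"
proof (subst vec_eq_iff, intro allI, subst vec_eq_iff, intro allI)
  fix i j
  have sums: "(\<lambda>k. matrix_exp_coeff A i j k * t ^ k) sums (matrix_exp (t *\<^sub>R A) $ i $ j)" for i j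
    unfolding matrix_exp_entry by (rule summable_sums[OF summable_matrix_exp_coeff])
  have "(\<lambda>k. \<Sum>l\<in>UNIV. matrix_exp_coeff A i l k * t ^ k * A $ l $ j) sums
      (matrix_exp (t *\<^sub>R A) ** A) $ i $ j"
    unfolding matrix_matrix_mult_def by (simp, intro sums_sum sums_mult2 sums)
  moreover have "(\<lambda>k. \<Sum>l\<in>UNIV. A $ i $ l * (matrix_exp_coeff A l j k * t ^ k)) sums
      (A ** matrix_exp (t *\<^sub>R A)) $ i $ j"
    unfolding matrix_matrix_mult_def by (simp, intro sums_sum sums_mult sums)
  moreover have "(\<Sum>l\<in>UNIV. matrix_exp_coeff A i l k * t ^ k * A $ l $ j) =
      (\<Sum>l\<in>UNIV. A $ i $ l * (matrix_exp_coeff A l j k * t ^ k))" for k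
  proof -
    have "(\<Sum>l\<in>UNIV. matrix_exp_coeff A i l k * t ^ k * A $ l $ j) =
        t ^ k / fact k * (matrix_power A k ** A) $ i $ j"
      by (simp add: matrix_matrix_mult_def matrix_exp_coeff_def sum_distrib_left field_simps)
    also have "\<dots> = (\<Sum>l\<in>UNIV. A $ i $ l * (matrix_exp_coeff A l j k * t ^ k))"
      by (simp add: matrix_power_commute)
        (simp add: matrix_matrix_mult_def matrix_exp_coeff_def sum_distrib_left field_simps)
    finally show ?thesis .
  qed
  ultimately show "(matrix_exp (t *\<^sub>R A) ** A) $ i $ j = (A ** matrix_exp (t *\<^sub>R A)) $ i $ j"
    by (simp add: sums_unique2)
qed

lemma has_vector_derivative_vec:
  fixes f :: "real \<Rightarrow> 'a::real_normed_vector^'n"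
  assumes "\<And>i. ((\<lambda>t. f t $ i) has_vector_derivative f' $ i) (at t within S)"
  shows "(f has_vector_derivative f') (at t within S)"
  unfolding has_vector_derivative_def has_derivative_within
proof (intro conjI vec_tendstoI)
  show "bounded_linear (\<lambda>h. h *\<^sub>R f')" by (rule bounded_linear_scaleR_left)
  fix i
  show "((\<lambda>y. ((1 / norm (y - t)) *\<^sub>R (f y - (f t + (y - t) *\<^sub>R f'))) $ i) \<longlongrightarrow> 0 $ i) (at t within S)"
    using assms[of i] unfolding has_vector_derivative_def has_derivative_within by simp
qed

lemma has_vector_derivative_matrix_exp:
  "((\<lambda>t. matrix_exp (t *\<^sub>R A)) has_vector_derivative A ** matrix_exp (t *\<^sub>R A)) (at t within S)"
proof (intro has_vector_derivative_vec)
  fix i j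
  have sums: "(\<lambda>k. matrix_exp_coeff A i j k * t ^ k) sums (matrix_exp (t *\<^sub>R A) $ i $ j)" for i j
    unfolding matrix_exp_entry by (rule summable_sums[OF summable_matrix_exp_coeff])
  \<comment> \<open>The factor k + 1 in \<open>diffs\<close> cancels against (k+1)!, which leaves
    the k-th coefficient of A times the series.\<close>
  have "diffs (matrix_exp_coeff A i j) k = (\<Sum>l\<in>UNIV. A $ i $ l * matrix_exp_coeff A l j k)" for k
  proof -
    have "diffs (matrix_exp_coeff A i j) k = (A ** matrix_power A k) $ i $ j / fact k"
      by (simp add: diffs_def matrix_exp_coeff_def del: of_nat_Suc)
    then show ?thesis
      by (simp add: matrix_exp_coeff_def matrix_matrix_mult_def sum_divide_distrib)
  qed
  then have "(\<lambda>k. diffs (matrix_exp_coeff A i j) k * t ^ k) =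
      (\<lambda>k. \<Sum>l\<in>UNIV. A $ i $ l * (matrix_exp_coeff A l j k * t ^ k))"
    by (simp add: sum_distrib_right mult.assoc)
  also have "\<dots> sums (A ** matrix_exp (t *\<^sub>R A)) $ i $ j"
    unfolding matrix_matrix_mult_def by (simp, intro sums_sum sums_mult sums)
  finally have "(\<Sum>k. diffs (matrix_exp_coeff A i j) k * t ^ k) = (A ** matrix_exp (t *\<^sub>R A)) $ i $ j"
    by (rule sums_unique[symmetric])
  then have "((\<lambda>t. matrix_exp (t *\<^sub>R A) $ i $ j) has_real_derivative
      (A ** matrix_exp (t *\<^sub>R A)) $ i $ j) (at t)"
    using termdiffs_strong_converges_everywhere[OF summable_matrix_exp_coeff, of A i j t]
    unfolding matrix_exp_entry by simp
  then show "((\<lambda>t. matrix_exp (t *\<^sub>R A) $ i $ j) has_vector_derivative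
      (A ** matrix_exp (t *\<^sub>R A)) $ i $ j) (at t within S)"
    by (simp add: has_real_derivative_iff_has_vector_derivative has_vector_derivative_at_within)
qed

text \<open>The functions B exp(tA) are closed under differentiation, \<open>B\<close> being
  replaced by \<open>B ** A\<close>.\<close>

lemma smooth_on_matrix_exp: "smooth_on S (\<lambda>t. matrix_exp (t *\<^sub>R A))"
proof (rule smooth_on_coinduct[where P = "\<lambda>f. \<exists>B. f = (\<lambda>t. B ** matrix_exp (t *\<^sub>R A))"])
  show "\<exists>B. (\<lambda>t. matrix_exp (t *\<^sub>R A)) = (\<lambda>t. B ** matrix_exp (t *\<^sub>R A))"
    by (rule exI[of _ "mat 1"]) simp
  fix f assume "\<exists>B. f = (\<lambda>t. B ** matrix_exp (t *\<^sub>R A))"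
  then obtain B where f: "f = (\<lambda>t. B ** matrix_exp (t *\<^sub>R A))" by blast
  have "(f has_vector_derivative (B ** A) ** matrix_exp (t *\<^sub>R A)) (at t within S)" for t
    unfolding f matrix_mul_assoc[symmetric]
    by (rule bounded_linear.has_vector_derivative[OF
          bounded_bilinear.bounded_linear_right[OF bounded_bilinear_matrix_mult]
          has_vector_derivative_matrix_exp])
  then show "\<exists>h. (\<exists>B. h = (\<lambda>t. B ** matrix_exp (t *\<^sub>R A))) \<and>
      (\<forall>t\<in>S. (f has_vector_derivative h t) (at t within S))"
    by blast
qed

lemma matrix_exp_zero: "matrix_exp (0 :: real^'n^'n) = mat 1"
proof -
  have "matrix_exp (0 *\<^sub>R (0 :: real^'n^'n)) $ i $ j = mat 1 $ i $ j" for i j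
    unfolding matrix_exp_entry powser_zero by (simp add: matrix_exp_coeff_def)
  then show ?thesis by (simp add: vec_eq_iff)
qed

text \<open>The product has derivative 0, because A commutes with exp(-tA), and it is the identity
  at t = 0. This is what later removes the integrating factor.\<close>

lemma matrix_exp_uminus_mult: "matrix_exp (t *\<^sub>R (- A)) ** matrix_exp (t *\<^sub>R A) = mat 1"
proof -
  let ?F = "\<lambda>t. matrix_exp (t *\<^sub>R (- A)) ** matrix_exp (t *\<^sub>R A)"
  have "(?F has_vector_derivative
      matrix_exp (t *\<^sub>R (- A)) ** (A ** matrix_exp (t *\<^sub>R A)) +
      ((- A) ** matrix_exp (t *\<^sub>R (- A))) ** matrix_exp (t *\<^sub>R A)) (at t)" for t
    by (intro bounded_bilinear.has_vector_derivative[OF bounded_bilinear_matrix_mult]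
        has_vector_derivative_matrix_exp)
  moreover have "matrix_exp (t *\<^sub>R (- A)) ** (A ** matrix_exp (t *\<^sub>R A)) +
      ((- A) ** matrix_exp (t *\<^sub>R (- A))) ** matrix_exp (t *\<^sub>R A) = 0" for t
  proof -
    have "(- A) ** matrix_exp (t *\<^sub>R (- A)) = - (matrix_exp (t *\<^sub>R (- A)) ** A)"
      by (simp only: matrix_exp_commute[symmetric] bounded_bilinear.minus_right[OF bounded_bilinear_matrix_mult])
    then show ?thesis
      by (simp add: matrix_mul_assoc bounded_bilinear.minus_left[OF bounded_bilinear_matrix_mult])
  qed
  ultimately have "(?F has_vector_derivative 0) (at t within UNIV)" for t by simp
  then obtain c where "\<And>t. ?F t = c"
    using has_vector_derivative_zero_constant[of UNIV ?F] by auto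
  then have "?F t = ?F 0" by metis
  then show ?thesis by (simp add: matrix_exp_zero)
qed

section \<open>Square integrable functions\<close>

lemma L2_measurable: "f \<in> L2 T \<Longrightarrow> f \<in> borel_measurable (lebesgue_on {0<..<T})"
  by (simp add: L2_def)

lemma integrable_const_lebesgue_on_interval: "integrable (lebesgue_on {0<..<T::real}) (\<lambda>_. c::real)"
  by (rule integral_lebesgue_on_greaterThanLessThan(1)) simp

text \<open>The interval has finite length and y \<le> 1 + y^2, so the norm is bounded by an
  integrable function.\<close>

lemma L2_locally_integrable:
  assumes "f \<in> L2 T" shows "locally_integrable T f"
proof -
  have "integrable (lebesgue_on {0<..<T}) f"
  proof (rule Bochner_Integration.integrable_bound)
    show "integrable (lebesgue_on {0<..<T}) (\<lambda>t. 1 + (norm (f t))\<^sup>2)"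
      using assms integrable_const_lebesgue_on_interval by (auto simp: L2_def)
    have "y \<le> 1 + y\<^sup>2" for y :: real
    proof -
      have "2 * y \<le> 1 + y\<^sup>2" using zero_le_power2[of "y - 1"] by (simp add: power2_diff)
      moreover have "0 \<le> y\<^sup>2" by simp
      ultimately show ?thesis by linarith
    qed
    then show "AE t in lebesgue_on {0<..<T}. norm (f t) \<le> norm (1 + (norm (f t))\<^sup>2)"
      by simp
  qed (rule L2_measurable[OF assms])
  then have "set_integrable lebesgue {0<..<T} f"
    by (simp add: set_integrable_def integrable_restrict_space)
  then show ?thesis
    unfolding locally_integrable_def by (auto intro: set_integrable_subset)
qed

lemma L2_bound:
  assumes "g \<in> L2 T" "f \<in> borel_measurable (lebesgue_on {0<..<T})"
    and "\<And>t. t \<in> {0<..<T} \<Longrightarrow> norm (f t) \<le> B * norm (g t)"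
  shows "f \<in> L2 T"
proof -
  have "integrable (lebesgue_on {0<..<T}) (\<lambda>t. (norm (f t))\<^sup>2)"
  proof (rule Bochner_Integration.integrable_bound)
    show "integrable (lebesgue_on {0<..<T}) (\<lambda>t. B\<^sup>2 * (norm (g t))\<^sup>2)"
      using assms(1) by (simp add: L2_def)
    show "(\<lambda>t. (norm (f t))\<^sup>2) \<in> borel_measurable (lebesgue_on {0<..<T})"
      using assms(2) by measurable
    show "AE t in lebesgue_on {0<..<T}. norm ((norm (f t))\<^sup>2) \<le> norm (B\<^sup>2 * (norm (g t))\<^sup>2)"
      using power_mono[OF assms(3), of _ 2] by (intro AE_I2) (simp add: power_mult_distrib)
  qed
  with assms(2) show ?thesis by (simp add: L2_def)
qed

lemma L2_add:
  assumes "f \<in> L2 T" "g \<in> L2 T" shows "(\<lambda>t. f t + g t) \<in> L2 T"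
proof -
  have "integrable (lebesgue_on {0<..<T}) (\<lambda>t. (norm (f t + g t))\<^sup>2)"
  proof (rule Bochner_Integration.integrable_bound)
    show "integrable (lebesgue_on {0<..<T}) (\<lambda>t. 2 * (norm (f t))\<^sup>2 + 2 * (norm (g t))\<^sup>2)"
      using assms by (simp add: L2_def)
    show "(\<lambda>t. (norm (f t + g t))\<^sup>2) \<in> borel_measurable (lebesgue_on {0<..<T})"
      using assms[THEN L2_measurable] by measurable
    have "(norm (a + b))\<^sup>2 \<le> 2 * (norm a)\<^sup>2 + 2 * (norm b)\<^sup>2" for a b :: 'a
    proof -
      have "(norm (a + b))\<^sup>2 \<le> (norm a + norm b)\<^sup>2"
        by (intro power_mono norm_triangle_ineq) simp
      also have "\<dots> \<le> 2 * (norm a)\<^sup>2 + 2 * (norm b)\<^sup>2"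
        using zero_le_power2[of "norm a - norm b"] by (simp add: power2_sum power2_diff)
      finally show ?thesis .
    qed
    then show "AE t in lebesgue_on {0<..<T}.
        norm ((norm (f t + g t))\<^sup>2) \<le> norm (2 * (norm (f t))\<^sup>2 + 2 * (norm (g t))\<^sup>2)"
      by simp
  qed
  with assms[THEN L2_measurable] show ?thesis by (simp add: L2_def)
qed

text \<open>Measurability passes to \<open>g\<close> because Lebesgue measure is complete; extension
  by 0 moves that question to the whole line.\<close>

lemma L2_cong_AE:
  fixes f g :: "real \<Rightarrow> 'a::euclidean_space"
  assumes "f \<in> L2 T" "AE t in lebesgue_on {0<..<T}. f t = g t"
  shows "g \<in> L2 T"
proof -
  have "AE t in lebesgue. t \<in> {0<..<T} \<longrightarrow> f t = g t"
    using assms(2) by (subst (asm) AE_restrict_space_iff) auto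
  then have ae: "AE t in lebesgue. (if t \<in> {0<..<T} then f t else 0) = (if t \<in> {0<..<T} then g t else 0)"
    by eventually_elim simp
  have "(\<lambda>t. if t \<in> {0<..<T} then f t else 0) \<in> borel_measurable lebesgue"
    using L2_measurable[OF assms(1)] by (subst borel_measurable_if) auto
  from borel_measurable_AE[OF this ae] have g: "g \<in> borel_measurable (lebesgue_on {0<..<T})"
    by (rule borel_measurable_if_D)
  have "integrable (lebesgue_on {0<..<T}) (\<lambda>t. (norm (g t))\<^sup>2)"
  proof (subst integrable_cong_AE)
    show "AE t in lebesgue_on {0<..<T}. (norm (g t))\<^sup>2 = (norm (f t))\<^sup>2"
      using assms(2) by eventually_elim simp
    show "(\<lambda>t. (norm (g t))\<^sup>2) \<in> borel_measurable (lebesgue_on {0<..<T})"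
      using g by measurable
    show "(\<lambda>t. (norm (f t))\<^sup>2) \<in> borel_measurable (lebesgue_on {0<..<T})"
      using L2_measurable[OF assms(1)] by measurable
  qed (use assms(1) in \<open>simp add: L2_def\<close>)
  with g show ?thesis by (simp add: L2_def)
qed

lemma L2_continuous:
  fixes f :: "real \<Rightarrow> 'a::euclidean_space"
  assumes "continuous_on {0..T} f" shows "f \<in> L2 T"
proof -
  have "continuous_on {0..T} (\<lambda>t. (norm (f t))\<^sup>2)"
    using assms by (intro continuous_intros)
  with assms show ?thesis
    by (auto simp: L2_def intro: integral_lebesgue_on_greaterThanLessThan(1) borel_measurable_integrable)
qed

section \<open>Matrix-vector products, Sobolev membership and boundary values\<close>

lemma bounded_bilinear_matrix_vector_mult:
  "bounded_bilinear ((*v) :: real^'n^'m \<Rightarrow> real^'n \<Rightarrow> real^'m)"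
  by (auto simp: bilinear_conv_bounded_bilinear[symmetric] bilinear_def vec_eq_iff
      matrix_vector_mult_def algebra_simps sum.distrib sum_distrib_left intro!: linearI)

lemma continuous_on_matrix_vector_mult [continuous_intros]:
  fixes A :: "'a::topological_space \<Rightarrow> real^'n^'m"
  shows "continuous_on S A \<Longrightarrow> continuous_on S u \<Longrightarrow> continuous_on S (\<lambda>t. A t *v u t)"
  by (rule bounded_bilinear.continuous_on[OF bounded_bilinear_matrix_vector_mult])

lemma L2_matrix_vector_mult:
  fixes A :: "real \<Rightarrow> real^'n^'m"
  assumes A: "continuous_on {0..T} A" and u: "u \<in> L2 T"
  shows "(\<lambda>t. A t *v u t) \<in> L2 T"
proof -
  obtain K where K: "0 < K" "\<And>A (x::real^'n). norm ((A::real^'n^'m) *v x) \<le> norm A * norm x * K"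
    using bounded_bilinear.pos_bounded[OF bounded_bilinear_matrix_vector_mult] by blast
  have "bounded (A ` {0..T})"
    using A by (intro compact_imp_bounded compact_continuous_image) auto
  then obtain B where B: "\<And>t. t \<in> {0..T} \<Longrightarrow> norm (A t) \<le> B"
    unfolding bounded_iff by blast
  show ?thesis
  proof (rule L2_bound[OF u])
    have "continuous_on {0<..<T} A"
      using A by (rule continuous_on_subset) auto
    then have "A \<in> borel_measurable (lebesgue_on {0<..<T})"
      by (rule continuous_imp_measurable_on_sets_lebesgue) simp
    then show "(\<lambda>t. A t *v u t) \<in> borel_measurable (lebesgue_on {0<..<T})"
      using L2_measurable[OF u]
      by (rule borel_measurable_continuous_Pair) (intro continuous_intros)
    show "norm (A t *v u t) \<le> (B * K) * norm (u t)" if "t \<in> {0<..<T}" for t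
    proof -
      have "norm (A t) * norm (u t) * K \<le> B * norm (u t) * K"
        using B[of t] that K(1) by (intro mult_right_mono) auto
      with K(2)[of "A t" "u t"] show ?thesis by (simp add: mult_ac)
    qed
  qed
qed

lemma L2_diff:
  assumes "f \<in> L2 T" "g \<in> L2 T" shows "(\<lambda>t. f t - g t) \<in> L2 T"
proof -
  have "(\<lambda>t. - g t) \<in> L2 T" using assms(2) by (simp add: L2_def)
  from L2_add[OF assms(1) this] show ?thesis by simp
qed

text \<open>Frees membership from the representative chosen by \<open>weak_deriv\<close>: any chain
  of two square integrable weak derivatives will do.\<close>

lemma H2_iff:
  fixes x :: "real \<Rightarrow> 'a::euclidean_space"
  assumes T: "0 < T"
  shows "x \<in> H2 T \<longleftrightarrow> x \<in> L2 T \<and>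
    (\<exists>g h. g \<in> L2 T \<and> h \<in> L2 T \<and> has_weak_derivative T x g \<and> has_weak_derivative T g h)"
proof
  assume "x \<in> H2 T"
  then obtain h where "x \<in> L2 T" "\<exists>g. has_weak_derivative T x g" "weak_deriv T x \<in> L2 T"
    "h \<in> L2 T" "has_weak_derivative T (weak_deriv T x) h"
    by (auto simp: H2_def H1_def)
  with weak_deriv_AE_eq(1)[OF T] show "x \<in> L2 T \<and>
    (\<exists>g h. g \<in> L2 T \<and> h \<in> L2 T \<and> has_weak_derivative T x g \<and> has_weak_derivative T g h)"
    by blast
next
  assume "x \<in> L2 T \<and>
    (\<exists>g h. g \<in> L2 T \<and> h \<in> L2 T \<and> has_weak_derivative T x g \<and> has_weak_derivative T g h)"
  then obtain g h where gh: "x \<in> L2 T" "g \<in> L2 T" "h \<in> L2 T"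
    "has_weak_derivative T x g" "has_weak_derivative T g h" by blast
  from gh weak_deriv_AE_eq(3)[OF T gh(4)] have "weak_deriv T x \<in> L2 T" "has_weak_derivative T (weak_deriv T x) h"
    by (auto intro: L2_cong_AE has_weak_derivative_cong_AE[OF T gh(5)])
  with gh show "x \<in> H2 T" by (auto simp: H2_def H1_def)
qed

text \<open>The continuous function |f - g| has integral 0 over [0,T] and hence vanishes everywhere,
  the end points included.\<close>

lemma continuous_AE_eq:
  fixes f g :: "real \<Rightarrow> 'a::euclidean_space"
  assumes T: "0 < T" and cont: "continuous_on {0..T} f" "continuous_on {0..T} g"
    and ae: "AE t in lebesgue_on {0<..<T}. f t = g t" and t: "t \<in> {0..T}"
  shows "f t = g t"
proof -
  have cont': "continuous_on {0..T} (\<lambda>t. norm (f t - g t))"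
    using cont by (intro continuous_intros)
  have "(LINT t|lebesgue_on {0<..<T}. norm (f t - g t)) = 0"
    by (rule integral_eq_zero_AE) (use ae in auto)
  then have "integral {0..T} (\<lambda>t. norm (f t - g t)) = 0"
    using integral_lebesgue_on_greaterThanLessThan(2)[OF cont'] by simp
  then show ?thesis
    using integral_eq_0_iff[OF cont' T] t by simp
qed

lemma has_boundary_values_add:
  assumes u: "has_boundary_values T u a b" and v: "continuous_on {0..T} v"
  shows "has_boundary_values T (\<lambda>t. u t + v t) (a + v 0) (b + v T)"
proof -
  obtain w where "continuous_on {0..T} w" "AE t in lebesgue_on {0<..<T}. u t = w t" "w 0 = a" "w T = b"
    using u by (auto simp: has_boundary_values_def)
  then show ?thesis
    unfolding has_boundary_values_def using v
    by (intro exI[of _ "\<lambda>t. w t + v t"]) (auto intro: continuous_on_add)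
qed

section \<open>The boundary value problem\<close>

text \<open>The integrating factor rule (E u)' = E (A u + u'); commutation moves the exponential to
  the front. It serves with \<open>Cb\<close> to form E x' and with \<open>- Cb\<close> to undo
  this.\<close>

lemma matrix_exp_mult_derivative:
  fixes A :: "real^'n^'n" and u g :: "real \<Rightarrow> real^'n"
  assumes "0 < T" "has_weak_derivative T u g"
  shows "has_weak_derivative T (\<lambda>t. matrix_exp (t *\<^sub>R A) *v u t)
    (\<lambda>t. matrix_exp (t *\<^sub>R A) *v (A *v u t + g t))"
  using has_weak_derivative_matrix_vector[OF assms smooth_on_matrix_exp has_vector_derivative_matrix_exp, of A]
  by (simp add: matrix_exp_commute[symmetric] matrix_vector_mul_assoc matrix_vector_right_distrib)

lemma matrix_exp_uminus_mult_vector: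
  "matrix_exp (t *\<^sub>R (- A)) *v (matrix_exp (t *\<^sub>R A) *v x) = x"
  by (simp only: matrix_vector_mul_assoc matrix_exp_uminus_mult matrix_vector_mul_lid)

lemma matrix_exp_mult_L2:
  fixes A :: "real^'n^'n" and u :: "real \<Rightarrow> real^'n"
  assumes "u \<in> L2 T" shows "(\<lambda>t. matrix_exp (t *\<^sub>R A) *v u t) \<in> L2 T"
  using assms by (intro L2_matrix_vector_mult smooth_on_imp_continuous_on smooth_on_matrix_exp)

text \<open>By linearity the terms in \<open>u\<close> and in the lift \<open>v\<close> combine, so
  that only \<open>x\<close> and its weak derivative \<open>g\<close> remain. The right side
  vanishes for all test functions exactly when E g has the weak derivative E (fb - Kb x).\<close>

lemma weak_lhs_minus_weak_rhs:
  fixes Cb Kb :: "real^'n^'n" and u v v' x g fb :: "real \<Rightarrow> real^'n"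
  assumes T: "0 < T" and \<phi>: "\<phi> \<in> test_functions T"
    and v': "continuous_on {0..T} v'"
      "\<And>t. t \<in> {0..T} \<Longrightarrow> (v has_vector_derivative v' t) (at t within {0..T})"
    and x: "x = (\<lambda>t. u t + v t)" "x \<in> L2 T" "g \<in> L2 T" "has_weak_derivative T x g"
    and fb: "fb \<in> L2 T"
  shows "weak_lhs T Cb Kb u \<phi> - weak_rhs T Cb Kb fb v \<phi> =
    - (LINT t|lebesgue_on {0<..<T}. vector_derivative \<phi> (at t) \<bullet> (matrix_exp (t *\<^sub>R Cb) *v g t))
    - (LINT t|lebesgue_on {0<..<T}. \<phi> t \<bullet> (matrix_exp (t *\<^sub>R Cb) *v (fb t - Kb *v x t)))"
proof -
  let ?E = "\<lambda>t. matrix_exp (t *\<^sub>R Cb)" and ?\<phi>' = "\<lambda>t. vector_derivative \<phi> (at t)"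
  let ?w = "\<lambda>t. vector_derivative v (at t within {0..T})"
  have u: "u = (\<lambda>t. x t - v t)" using x(1) by simp
  have cont_v: "continuous_on {0..T} v" using v'(2) by (rule continuous_on_vector_derivative)
  have "has_weak_derivative T u (\<lambda>t. g t - v' t)"
    unfolding u by (intro has_weak_derivative_diff has_weak_derivative_C1 T x(4) v')
  then have u': "AE t in lebesgue_on {0<..<T}. g t - v' t = weak_deriv T u t"
    by (rule weak_deriv_AE_eq(3)[OF T])
  have v'_L2: "v' \<in> L2 T" "v \<in> L2 T" using v'(1) cont_v by (auto intro: L2_continuous)
  \<comment> \<open>\<open>weak_rhs\<close> takes the derivative of \<open>v\<close> within [0,T];
    such derivatives are unique, so it coincides with \<open>v'\<close>.\<close>
  have w: "AE t in lebesgue_on {0<..<T}. v' t = ?w t"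
    using vector_derivative_within_closed_interval[OF T _ v'(2)] by (intro AE_I2) auto
  have w_L2: "?w \<in> L2 T" using v'_L2(1) w by (rule L2_cong_AE)
  have u'_L2: "weak_deriv T u \<in> L2 T"
    using L2_diff[OF x(3) v'_L2(1)] u' by (rule L2_cong_AE)
  have u_L2: "u \<in> L2 T" unfolding u by (intro L2_diff x v'_L2)
  have K_L2: "(\<lambda>t. Kb *v y t) \<in> L2 T" if "y \<in> L2 T" for y
    using that by (intro L2_matrix_vector_mult continuous_on_const)
  have int: "integrable (lebesgue_on {0<..<T}) (\<lambda>t. \<psi> t \<bullet> (?E t *v y t))"
    if "\<psi> \<in> test_functions T" "y \<in> L2 T" for \<psi> y
    using that by (intro integral_test_function_inner(1)[OF T] L2_locally_integrable matrix_exp_mult_L2)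
  note \<phi>' = test_function_derivative[OF T \<phi>]
  have "(LINT t|lebesgue_on {0<..<T}. ?\<phi>' t \<bullet> (?E t *v weak_deriv T u t)) +
      (LINT t|lebesgue_on {0<..<T}. ?\<phi>' t \<bullet> (?E t *v ?w t)) =
      (LINT t|lebesgue_on {0<..<T}. ?\<phi>' t \<bullet> (?E t *v weak_deriv T u t) + ?\<phi>' t \<bullet> (?E t *v ?w t))"
    by (intro Bochner_Integration.integral_add[symmetric] int \<phi>' u'_L2 w_L2)
  also have "\<dots> = (LINT t|lebesgue_on {0<..<T}. ?\<phi>' t \<bullet> (?E t *v g t))"
  proof (rule integral_cong_AE)
    show "AE t in lebesgue_on {0<..<T}.
        ?\<phi>' t \<bullet> (?E t *v weak_deriv T u t) + ?\<phi>' t \<bullet> (?E t *v ?w t) = ?\<phi>' t \<bullet> (?E t *v g t)"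
      using u' w
    proof eventually_elim
      case (elim t)
      then have "g t = weak_deriv T u t + ?w t" by (simp add: algebra_simps)
      then show ?case by (simp only: matrix_vector_right_distrib inner_add_right)
    qed
  qed (intro borel_measurable_add borel_measurable_integrable int \<phi>' u'_L2 w_L2 x)+
  finally have 1: "(LINT t|lebesgue_on {0<..<T}. ?\<phi>' t \<bullet> (?E t *v weak_deriv T u t)) +
      (LINT t|lebesgue_on {0<..<T}. ?\<phi>' t \<bullet> (?E t *v ?w t)) =
      (LINT t|lebesgue_on {0<..<T}. ?\<phi>' t \<bullet> (?E t *v g t))" .
  \<comment> \<open>The terms with undifferentiated \<phi> collect into fb - Kb (u + v).\<close>
  have "(LINT t|lebesgue_on {0<..<T}. \<phi> t \<bullet> (?E t *v fb t)) -
      ((LINT t|lebesgue_on {0<..<T}. \<phi> t \<bullet> (?E t *v (Kb *v u t))) +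
       (LINT t|lebesgue_on {0<..<T}. \<phi> t \<bullet> (?E t *v (Kb *v v t)))) =
      (LINT t|lebesgue_on {0<..<T}. \<phi> t \<bullet> (?E t *v fb t) -
        (\<phi> t \<bullet> (?E t *v (Kb *v u t)) + \<phi> t \<bullet> (?E t *v (Kb *v v t))))"
    using int[OF \<phi> fb] int[OF \<phi> K_L2[OF u_L2]] int[OF \<phi> K_L2[OF v'_L2(2)]] by simp
  also have "\<dots> = (LINT t|lebesgue_on {0<..<T}. \<phi> t \<bullet> (?E t *v (fb t - Kb *v x t)))"
    by (simp add: x(1) matrix_vector_right_distrib matrix_vector_mult_diff_distrib
        inner_add_right inner_diff_right)
  finally show ?thesis
    using 1 unfolding weak_lhs_def weak_rhs_def by linarith
qed

text \<open>Common form of the strong and classical problems, without the arbitrary representatives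
  chosen by \<^const>\<open>weak_deriv\<close>.\<close>

definition solves_normalized ::
    "real \<Rightarrow> real^'n^'n \<Rightarrow> real^'n^'n \<Rightarrow> (real \<Rightarrow> real^'n) \<Rightarrow> (real \<Rightarrow> real^'n) \<Rightarrow>
     (real \<Rightarrow> real^'n) \<Rightarrow> (real \<Rightarrow> real^'n) \<Rightarrow> bool" where
  "solves_normalized T Cb Kb fb x g h \<longleftrightarrow>
     x \<in> L2 T \<and> g \<in> L2 T \<and> h \<in> L2 T \<and> has_weak_derivative T x g \<and> has_weak_derivative T g h \<and>
     (AE t in lebesgue_on {0<..<T}. h t + Cb *v g t + Kb *v x t = fb t)"

text \<open>Any admissible \<open>g\<close> and \<open>h\<close> differ from the iterated
  \<open>weak_deriv\<close> only on null sets, so the equation holds for one pair if and only if it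
  holds for the other. The assumption \<open>eq\<close> carries the normalization by the mass
  matrix.\<close>

lemma strong_solution_iff:
  fixes M C K :: "real^'n^'n"
  assumes T: "0 < T" and eq: "\<And>a b c t. M *v a + C *v b + K *v c = f t \<longleftrightarrow> a + Cb *v b + Kb *v c = fb t"
  shows "strong_solution T M C K f x\<^sub>0 x\<^sub>T x \<longleftrightarrow>
    (\<exists>g h. solves_normalized T Cb Kb fb x g h) \<and> has_boundary_values T x x\<^sub>0 x\<^sub>T"
proof -
  let ?x' = "weak_deriv T x"
  let ?x'' = "weak_deriv T ?x'"
  have "x \<in> H2 T \<and> (AE t in lebesgue_on {0<..<T}. ?x'' t + Cb *v ?x' t + Kb *v x t = fb t) \<longleftrightarrow>
    (\<exists>g h. solves_normalized T Cb Kb fb x g h)" (is "?L \<longleftrightarrow> ?R")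
  proof
    assume L: ?L
    then obtain g h where gh: "x \<in> L2 T" "g \<in> L2 T" "h \<in> L2 T"
      "has_weak_derivative T x g" "has_weak_derivative T g h"
      unfolding H2_iff[OF T] by blast
    note x' = weak_deriv_AE_eq[OF T gh(4)]
    \<comment> \<open>The second \<open>weak_deriv\<close> is taken of
      \<open>weak_deriv T x\<close>, not of \<open>g\<close>, so \<open>h\<close> must first be
      moved along their agreement almost everywhere.\<close>
    have "has_weak_derivative T ?x' h"
      using T gh(5) x'(3) by (rule has_weak_derivative_cong_AE) simp
    note x'' = weak_deriv_AE_eq[OF T this]
    have "?x' \<in> L2 T" "?x'' \<in> L2 T"
      using L2_cong_AE[OF gh(2) x'(3)] L2_cong_AE[OF gh(3) x''(3)] by auto
    then show ?R
      using L gh(1) x'(1) x''(1) unfolding solves_normalized_def by blast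
  next
    assume ?R
    then obtain g h where gh: "x \<in> L2 T" "g \<in> L2 T" "h \<in> L2 T"
      "has_weak_derivative T x g" "has_weak_derivative T g h"
      "AE t in lebesgue_on {0<..<T}. h t + Cb *v g t + Kb *v x t = fb t"
      unfolding solves_normalized_def by blast
    note x' = weak_deriv_AE_eq[OF T gh(4)]
    have "has_weak_derivative T ?x' h"
      using T gh(5) x'(3) by (rule has_weak_derivative_cong_AE) simp
    note x'' = weak_deriv_AE_eq[OF T this]
    have "AE t in lebesgue_on {0<..<T}. ?x'' t + Cb *v ?x' t + Kb *v x t = fb t"
      using gh(6) x'(2) x''(2) by eventually_elim simp
    moreover have "x \<in> H2 T" unfolding H2_iff[OF T] using gh by blast
    ultimately show ?L by blast
  qed
  then show ?thesis unfolding strong_solution_def eq by blast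
qed

text \<open>Since the lift is C^1 up to the ends, adding it preserves membership in
  \<open>H1\<close> and shifts the boundary values from 0 to those of \<open>v\<close>. For a fixed
  weak derivative \<open>g\<close> of x, what is left is to insert or remove the exponential
  factor.\<close>

lemma weak_solution_iff:
  fixes Cb Kb :: "real^'n^'n" and u v v' fb :: "real \<Rightarrow> real^'n"
  assumes T: "0 < T"
    and v': "continuous_on {0..T} v'"
      "\<And>t. t \<in> {0..T} \<Longrightarrow> (v has_vector_derivative v' t) (at t within {0..T})"
    and fb: "fb \<in> L2 T"
  shows "weak_solution T Cb Kb fb v u \<longleftrightarrow>
    (\<exists>g h. solves_normalized T Cb Kb fb (\<lambda>t. u t + v t) g h) \<and>
    has_boundary_values T (\<lambda>t. u t + v t) (v 0) (v T)"
proof -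
  let ?E = "\<lambda>t. matrix_exp (t *\<^sub>R Cb)" and ?F = "\<lambda>t. matrix_exp (t *\<^sub>R (- Cb))"
  define x where "x = (\<lambda>t. u t + v t)"
  have u: "u = (\<lambda>t. x t - v t)" by (simp add: x_def)
  have cont_v: "continuous_on {0..T} v" using v'(2) by (rule continuous_on_vector_derivative)
  have v_L2: "v \<in> L2 T" "v' \<in> L2 T" using cont_v v'(1) by (auto intro: L2_continuous)
  have v_weak: "has_weak_derivative T v v'" using T v' by (rule has_weak_derivative_C1)
  have boundary: "has_boundary_values T u 0 0 \<longleftrightarrow> has_boundary_values T x (v 0) (v T)"
  proof
    assume "has_boundary_values T u 0 0"
    from has_boundary_values_add[OF this cont_v] show "has_boundary_values T x (v 0) (v T)"
      by (simp add: x_def)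
  next
    assume "has_boundary_values T x (v 0) (v T)"
    from has_boundary_values_add[OF this continuous_on_minus[OF cont_v]]
    show "has_boundary_values T u 0 0" by (simp add: u)
  qed
  have H1: "u \<in> H1 T \<longleftrightarrow> x \<in> L2 T \<and> (\<exists>g. g \<in> L2 T \<and> has_weak_derivative T x g)"
  proof
    assume "u \<in> H1 T"
    then obtain g where "u \<in> L2 T" "g \<in> L2 T" "has_weak_derivative T u g" by (auto simp: H1_def)
    then show "x \<in> L2 T \<and> (\<exists>g. g \<in> L2 T \<and> has_weak_derivative T x g)"
      unfolding x_def using v_L2 v_weak has_weak_derivative_add[OF T] L2_add by blast
  next
    assume "x \<in> L2 T \<and> (\<exists>g. g \<in> L2 T \<and> has_weak_derivative T x g)"
    then obtain g where "x \<in> L2 T" "g \<in> L2 T" "has_weak_derivative T x g" by blast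
    then show "u \<in> H1 T"
      unfolding u H1_def using v_L2 v_weak has_weak_derivative_diff[OF T] L2_diff by blast
  qed
  have eq: "(\<forall>\<phi>\<in>test_functions T. weak_lhs T Cb Kb u \<phi> = weak_rhs T Cb Kb fb v \<phi>) \<longleftrightarrow>
      has_weak_derivative T (\<lambda>t. ?E t *v g t) (\<lambda>t. ?E t *v (fb t - Kb *v x t))"
    if g: "x \<in> L2 T" "g \<in> L2 T" "has_weak_derivative T x g" for g
  proof -
    have "(\<lambda>t. fb t - Kb *v x t) \<in> L2 T"
      using g fb by (intro L2_diff L2_matrix_vector_mult continuous_on_const)
    then have loc: "locally_integrable T (\<lambda>t. ?E t *v g t)"
      "locally_integrable T (\<lambda>t. ?E t *v (fb t - Kb *v x t))"
      using g by (auto intro: L2_locally_integrable matrix_exp_mult_L2)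
    have "weak_lhs T Cb Kb u \<phi> = weak_rhs T Cb Kb fb v \<phi> \<longleftrightarrow>
        (LINT t|lebesgue_on {0<..<T}. vector_derivative \<phi> (at t) \<bullet> (?E t *v g t)) =
        - (LINT t|lebesgue_on {0<..<T}. \<phi> t \<bullet> (?E t *v (fb t - Kb *v x t)))"
      if "\<phi> \<in> test_functions T" for \<phi>
      using weak_lhs_minus_weak_rhs[OF T that v' x_def g fb, of Cb Kb] by linarith
    then show ?thesis
      using has_weak_derivative_iff_vector_test_functions[OF T loc] by simp
  qed
  have second: "has_weak_derivative T (\<lambda>t. ?E t *v g t) (\<lambda>t. ?E t *v (fb t - Kb *v x t)) \<longleftrightarrow>
      (\<exists>h. solves_normalized T Cb Kb fb x g h)" (is "?L \<longleftrightarrow> ?R")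
    if g: "x \<in> L2 T" "g \<in> L2 T" "has_weak_derivative T x g" for g
  proof
    assume ?L
    \<comment> \<open>Multiplying by the inverse exponential recovers \<open>g\<close>; the
      derivative of \<open>?F\<close> contributes the damping term.\<close>
    from matrix_exp_mult_derivative[OF T this, of "- Cb"]
    have "has_weak_derivative T (\<lambda>t. ?F t *v (?E t *v g t))
        (\<lambda>t. ?F t *v (- Cb *v (?E t *v g t) + ?E t *v (fb t - Kb *v x t)))" .
    moreover have "?F t *v (- Cb *v (?E t *v g t) + ?E t *v (fb t - Kb *v x t)) =
        fb t - Kb *v x t - Cb *v g t" for t
    proof -
      \<comment> \<open>Since \<open>Cb\<close> commutes with \<open>?E\<close>, the exponential can
        be factored out and then cancelled.\<close>
      have "- Cb *v (?E t *v g t) + ?E t *v (fb t - Kb *v x t) =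
          ?E t *v (fb t - Kb *v x t - Cb *v g t)"
        by (simp add: matrix_vector_mult_diff_distrib matrix_vector_mul_assoc matrix_exp_commute[symmetric]
            bounded_bilinear.minus_left[OF bounded_bilinear_matrix_vector_mult]
            bounded_bilinear.minus_left[OF bounded_bilinear_matrix_mult])
      then show ?thesis by (simp only: matrix_exp_uminus_mult_vector)
    qed
    ultimately have "has_weak_derivative T g (\<lambda>t. fb t - Kb *v x t - Cb *v g t)"
      by (simp only: matrix_exp_uminus_mult_vector)
    moreover have "(\<lambda>t. fb t - Kb *v x t - Cb *v g t) \<in> L2 T"
      using g fb by (intro L2_diff L2_matrix_vector_mult continuous_on_const)
    ultimately show ?R
      unfolding solves_normalized_def using g
      by (intro exI[of _ "\<lambda>t. fb t - Kb *v x t - Cb *v g t"]) auto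
  next
    assume ?R
    then obtain h where h: "has_weak_derivative T g h"
      "AE t in lebesgue_on {0<..<T}. h t + Cb *v g t + Kb *v x t = fb t"
      by (auto simp: solves_normalized_def)
    \<comment> \<open>The left side is the derivative of E g given by the integrating factor rule;
      the equation rewrites it.\<close>
    have "AE t in lebesgue_on {0<..<T}. ?E t *v (Cb *v g t + h t) = ?E t *v (fb t - Kb *v x t)"
      using h(2) by eventually_elim (metis add.commute add_diff_cancel_right')
    then show ?L
      by (intro has_weak_derivative_cong_AE[OF T matrix_exp_mult_derivative[OF T h(1)]]) auto
  qed
  show ?thesis
    unfolding weak_solution_def H10_def mem_Collect_eq H1 boundary x_def[symmetric]
    using eq second unfolding solves_normalized_def by blast
qed

text \<open>Weak solutions are determined only up to null sets, so a classical solution can be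
  required only to agree with \<open>x\<close> almost everywhere. It is found as the continuous
  representative \<open>w\<close> that the boundary condition supplies.\<close>

lemma classical_solution_iff:
  fixes M C K Cb Kb :: "real^'n^'n" and f fb x :: "real \<Rightarrow> real^'n"
  assumes T: "0 < T" and fb: "continuous_on {0..T} fb"
    and eq: "\<And>a b c t. M *v a + C *v b + K *v c = f t \<longleftrightarrow> a + Cb *v b + Kb *v c = fb t"
  shows "(\<exists>y. classical_solution T M C K f x\<^sub>0 x\<^sub>T y \<and> (AE t in lebesgue_on {0<..<T}. y t = x t)) \<longleftrightarrow>
    (\<exists>g h. solves_normalized T Cb Kb fb x g h) \<and> has_boundary_values T x x\<^sub>0 x\<^sub>T"
proof
  assume "\<exists>y. classical_solution T M C K f x\<^sub>0 x\<^sub>T y \<and> (AE t in lebesgue_on {0<..<T}. y t = x t)"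
  then obtain y y' y'' where ae: "AE t in lebesgue_on {0<..<T}. y t = x t"
    and y'': "continuous_on {0..T} y''" and bc: "y 0 = x\<^sub>0" "y T = x\<^sub>T"
    and y: "\<And>t. t \<in> {0..T} \<Longrightarrow> (y has_vector_derivative y' t) (at t within {0..T})"
      "\<And>t. t \<in> {0..T} \<Longrightarrow> (y' has_vector_derivative y'' t) (at t within {0..T})"
      "\<And>t. t \<in> {0..T} \<Longrightarrow> y'' t + Cb *v y' t + Kb *v y t = fb t"
    unfolding classical_solution_def eq by blast
  have cont: "continuous_on {0..T} y" "continuous_on {0..T} y'"
    using continuous_on_vector_derivative[OF y(1)] continuous_on_vector_derivative[OF y(2)] by auto
  have "has_weak_derivative T y y'" "has_weak_derivative T y' y''"
    using T cont y'' y by (auto intro: has_weak_derivative_C1)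
  then have "has_weak_derivative T x y'" "has_weak_derivative T y' y''"
    by (auto intro: has_weak_derivative_cong_AE[OF T _ ae])
  moreover have "y' \<in> L2 T" "y'' \<in> L2 T" "x \<in> L2 T"
    using cont y'' by (auto intro: L2_continuous L2_cong_AE[OF _ ae])
  \<comment> \<open>\<open>AE_space\<close> provides that t lies in (0,T), where the pointwise
    equation is available.\<close>
  moreover have "AE t in lebesgue_on {0<..<T}. y'' t + Cb *v y' t + Kb *v x t = fb t"
    using ae AE_space
  proof eventually_elim
    case (elim t)
    then have "t \<in> {0..T}" by simp
    from y(3)[OF this] elim(1) show ?case by simp
  qed
  moreover have "AE t in lebesgue_on {0<..<T}. x t = y t"
    using ae by (simp add: eq_commute)
  then have "has_boundary_values T x x\<^sub>0 x\<^sub>T"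
    unfolding has_boundary_values_def using cont(1) bc by blast
  ultimately show "(\<exists>g h. solves_normalized T Cb Kb fb x g h) \<and> has_boundary_values T x x\<^sub>0 x\<^sub>T"
    unfolding solves_normalized_def by blast
next
  assume "(\<exists>g h. solves_normalized T Cb Kb fb x g h) \<and> has_boundary_values T x x\<^sub>0 x\<^sub>T"
  then obtain g h w where gh: "has_weak_derivative T x g" "has_weak_derivative T g h"
      "AE t in lebesgue_on {0<..<T}. h t + Cb *v g t + Kb *v x t = fb t"
    and w: "continuous_on {0..T} w" "AE t in lebesgue_on {0<..<T}. x t = w t" "w 0 = x\<^sub>0" "w T = x\<^sub>T"
    unfolding solves_normalized_def has_boundary_values_def by blast
  let ?E = "\<lambda>t. matrix_exp (t *\<^sub>R Cb)" and ?F = "\<lambda>t. matrix_exp (t *\<^sub>R (- Cb))"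
  \<comment> \<open>With \<open>w\<close> in place of \<open>x\<close> the right side is continuous
    and has a C^1 primitive.\<close>
  let ?r = "\<lambda>t. ?E t *v (fb t - Kb *v w t)"
  have cont_E: "continuous_on {0..T} ?E" "continuous_on {0..T} ?F"
    by (intro smooth_on_imp_continuous_on smooth_on_matrix_exp)+
  have r: "continuous_on {0..T} ?r"
    using cont_E fb w(1) by (intro continuous_intros)
  define R where "R t = integral {0..t} ?r" for t
  have R: "(R has_vector_derivative ?r t) (at t within {0..T})" if "t \<in> {0..T}" for t
    unfolding R_def using r that by (rule integral_has_vector_derivative)
  have "AE t in lebesgue_on {0<..<T}. ?E t *v (Cb *v g t + h t) = ?r t"
    using gh(3) w(2) by eventually_elim (metis add.commute add_diff_cancel_right')
  then have "has_weak_derivative T (\<lambda>t. ?E t *v g t) ?r"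
    by (intro has_weak_derivative_cong_AE[OF T matrix_exp_mult_derivative[OF T gh(2)]]) auto
  from has_weak_derivative_diff[OF T this has_weak_derivative_C1[OF T r R]]
  obtain c where c: "AE t in lebesgue_on {0<..<T}. ?E t *v g t - R t = c"
    using has_weak_derivative_zero_imp_AE_const[OF T] by auto
  \<comment> \<open>Solving E g = R + c for g gives a representative of the first derivative that is
    differentiable at every point.\<close>
  define p where "p t = ?F t *v (R t + c)" for t
  have gp: "AE t in lebesgue_on {0<..<T}. g t = p t"
    using c
  proof eventually_elim
    case (elim t)
    then have "R t + c = ?E t *v g t" by (simp add: algebra_simps)
    then show ?case by (simp only: p_def matrix_exp_uminus_mult_vector)
  qed
  \<comment> \<open>The second derivative that the normalized equation dictates; differentiating
    \<open>p\<close> confirms it.\<close>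
  define q where "q t = fb t - Cb *v p t - Kb *v w t" for t
  have p': "(p has_vector_derivative q t) (at t within {0..T})" if t: "t \<in> {0..T}" for t
  proof -
    have "((\<lambda>t. R t + c) has_vector_derivative ?r t) (at t within {0..T})"
      using has_vector_derivative_add[OF R[OF t] has_vector_derivative_const] by simp
    from bounded_bilinear.has_vector_derivative[OF bounded_bilinear_matrix_vector_mult
        has_vector_derivative_matrix_exp this, of "- Cb"]
    have "(p has_vector_derivative ?F t *v ?r t + (- Cb ** ?F t) *v (R t + c)) (at t within {0..T})"
      by (simp only: p_def[abs_def])
    \<comment> \<open>The first summand reduces to fb - Kb w because \<open>?F\<close> inverts
      \<open>?E\<close>, the second to -Cb p by the definition of \<open>p\<close>.\<close>
    moreover have "?F t *v ?r t + (- Cb ** ?F t) *v (R t + c) = q t"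
      by (simp only: matrix_exp_uminus_mult_vector matrix_vector_mul_assoc[symmetric]
          bounded_bilinear.minus_left[OF bounded_bilinear_matrix_vector_mult] p_def[symmetric])
        (simp add: q_def)
    ultimately show ?thesis by simp
  qed
  have p: "continuous_on {0..T} p"
    using p' by (rule continuous_on_vector_derivative)
  have q: "continuous_on {0..T} q"
    unfolding q_def using fb p w(1) by (intro continuous_intros)
  \<comment> \<open>Second run of the argument, now one order lower: \<open>w\<close> and
    \<open>P\<close> have the same weak derivative.\<close>
  define P where "P t = integral {0..t} p" for t
  have P: "(P has_vector_derivative p t) (at t within {0..T})" if "t \<in> {0..T}" for t
    unfolding P_def using p that by (rule integral_has_vector_derivative)
  have "has_weak_derivative T w p"
    using gh(1) w(2) gp by (rule has_weak_derivative_cong_AE[OF T])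
  from has_weak_derivative_diff[OF T this has_weak_derivative_C1[OF T p P]]
  obtain d where d: "AE t in lebesgue_on {0<..<T}. w t - P t = d"
    using has_weak_derivative_zero_imp_AE_const[OF T] by auto
  \<comment> \<open>Continuity upgrades the equality to all of [0,T], so \<open>w\<close> is
    differentiable also at the ends, in the one-sided sense.\<close>
  have "w t = P t + d" if "t \<in> {0..T}" for t
  proof (rule continuous_AE_eq[OF T w(1) _ _ that])
    show "continuous_on {0..T} (\<lambda>t. P t + d)"
      using continuous_on_vector_derivative[OF P] by (intro continuous_on_add continuous_on_const)
    show "AE t in lebesgue_on {0<..<T}. w t = P t + d"
      using d by eventually_elim (simp add: algebra_simps)
  qed
  moreover have "((\<lambda>t. P t + d) has_vector_derivative p t) (at t within {0..T})" if "t \<in> {0..T}" for t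
    using has_vector_derivative_add[OF P[OF that] has_vector_derivative_const] by simp
  ultimately have w': "(w has_vector_derivative p t) (at t within {0..T})" if "t \<in> {0..T}" for t
    using that by (auto intro: has_vector_derivative_transform[of t "{0..T}" w "\<lambda>t. P t + d"])
  have "classical_solution T M C K f x\<^sub>0 x\<^sub>T w"
    unfolding classical_solution_def eq
    by (intro conjI w(3,4), rule exI[of _ p], rule exI[of _ q], intro conjI ballI q w' p')
      (simp_all add: q_def)
  moreover have "AE t in lebesgue_on {0<..<T}. w t = x t"
    using w(2) by (simp add: eq_commute)
  ultimately show "\<exists>y. classical_solution T M C K f x\<^sub>0 x\<^sub>T y \<and> (AE t in lebesgue_on {0<..<T}. y t = x t)"
    by blast
qed

section \<open>The mass matrix and the boundary lift\<close>

lemma positive_definite_matrix_inv: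
  assumes "positive_definite M"
  shows "matrix_inv M ** M = mat 1" "M ** matrix_inv M = mat 1"
proof -
  \<comment> \<open>A kernel vector makes the quadratic form of M vanish, which positive
    definiteness allows only for 0.\<close>
  have "x = 0" if "M *v x = 0" for x
    using assms that unfolding positive_definite_def by force
  then have "invertible M"
    by (simp add: invertible_left_inverse matrix_left_invertible_ker)
  then show "matrix_inv M ** M = mat 1" "M ** matrix_inv M = mat 1"
    unfolding invertible_def matrix_inv_def by (rule someI2_ex, simp)+
qed

lemma boundary_lift_C1:
  fixes V\<^sub>0 V\<^sub>T :: "real \<Rightarrow> real^'n^'n"
  assumes "smooth_on {0..T} V\<^sub>0" "smooth_on {0..T} V\<^sub>T"
  obtains v' where "continuous_on {0..T} v'"
    "\<And>t. t \<in> {0..T} \<Longrightarrow>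
      (boundary_lift V\<^sub>0 V\<^sub>T x\<^sub>0 x\<^sub>T has_vector_derivative v' t) (at t within {0..T})"
proof -
  have "smooth_on {0..T} (boundary_lift V\<^sub>0 V\<^sub>T x\<^sub>0 x\<^sub>T)"
    unfolding boundary_lift_def[abs_def]
    by (rule smooth_on_add; rule smooth_on_linear[OF
          bounded_bilinear.bounded_linear_left[OF bounded_bilinear_matrix_vector_mult]])
      (use assms in auto)
  then obtain v' where "smooth_on {0..T} v'" "\<And>t. t \<in> {0..T} \<Longrightarrow>
      (boundary_lift V\<^sub>0 V\<^sub>T x\<^sub>0 x\<^sub>T has_vector_derivative v' t) (at t within {0..T})"
    by (rule smooth_on_derivative) blast
  then show ?thesis
    by (rule that[OF smooth_on_imp_continuous_on])
qed

text \<open>Diagonality together with the prescribed diagonal entries makes the matrices at the ends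
  the identity or zero.\<close>

lemma boundary_lift_values:
  fixes V\<^sub>0 V\<^sub>T :: "real \<Rightarrow> real^'n^'n"
  assumes T: "0 < T" and diag: "\<forall>t\<in>{0..T}. diagonal_matrix (V\<^sub>0 t) \<and> diagonal_matrix (V\<^sub>T t)"
    and entries: "\<forall>i. V\<^sub>0 0 $ i $ i = 1 \<and> V\<^sub>T T $ i $ i = 1 \<and> V\<^sub>0 T $ i $ i = 0 \<and> V\<^sub>T 0 $ i $ i = 0"
  shows "boundary_lift V\<^sub>0 V\<^sub>T x\<^sub>0 x\<^sub>T 0 = x\<^sub>0" "boundary_lift V\<^sub>0 V\<^sub>T x\<^sub>0 x\<^sub>T T = x\<^sub>T"
proof -
  have "A = mat 1" if "diagonal_matrix A" "\<And>i. A $ i $ i = 1" for A :: "real^'n^'n"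
    using that by (auto simp: vec_eq_iff mat_def diagonal_matrix_def)
  moreover have "A = 0" if "diagonal_matrix A" "\<And>i. A $ i $ i = 0" for A :: "real^'n^'n"
    unfolding vec_eq_iff
  proof (intro allI)
    fix i j show "A $ i $ j = 0 $ i $ j"
      using that by (cases "i = j") (auto simp: diagonal_matrix_def)
  qed
  ultimately have "V\<^sub>0 0 = mat 1" "V\<^sub>T T = mat 1" "V\<^sub>0 T = 0" "V\<^sub>T 0 = 0"
    using T diag entries by simp_all
  then show "boundary_lift V\<^sub>0 V\<^sub>T x\<^sub>0 x\<^sub>T 0 = x\<^sub>0" "boundary_lift V\<^sub>0 V\<^sub>T x\<^sub>0 x\<^sub>T T = x\<^sub>T"
    by (simp_all add: boundary_lift_def)
qed

text \<open>The notion of weak form is made precise by two equivalences, one for each regularity of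
  the forcing, and by a residual identity. The latter records the passage itself, multiplication by
  the exponential followed by one integration by parts, and presupposes neither the equation nor
  boundary values of x.\<close>

theorem theorem8p1:
  fixes M C K Cb Kb :: "real^'n^'n"
    and f fb v :: "real \<Rightarrow> real^'n"
    and T :: real
    and x\<^sub>0 x\<^sub>T :: "real^'n"
    and V\<^sub>0 V\<^sub>T :: "real \<Rightarrow> real^'n^'n"
  assumes "symmetric_matrix M" "symmetric_matrix C" "symmetric_matrix K"
    and "positive_definite M" "positive_definite K"
    and "Cb = matrix_inv M ** C" "Kb = matrix_inv M ** K" "fb = (\<lambda>t. matrix_inv M *v f t)"
    and "0 < T"
    and "smooth_on {0..T} V\<^sub>0" "smooth_on {0..T} V\<^sub>T"
    and "\<forall>t\<in>{0..T}. diagonal_matrix (V\<^sub>0 t) \<and> diagonal_matrix (V\<^sub>T t)"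
    and "\<forall>i. V\<^sub>0 0 $ i $ i = 1 \<and> V\<^sub>T T $ i $ i = 1 \<and> V\<^sub>0 T $ i $ i = 0 \<and> V\<^sub>T 0 $ i $ i = 0"
    and "v = boundary_lift V\<^sub>0 V\<^sub>T x\<^sub>0 x\<^sub>T"
    and "f \<in> L2 T"
  shows
    "(\<forall>u. weak_solution T Cb Kb fb v u \<longleftrightarrow>
          strong_solution T M C K f x\<^sub>0 x\<^sub>T (\<lambda>t. u t + v t)) \<and>
     (continuous_on {0..T} f \<longrightarrow>
       (\<forall>u. weak_solution T Cb Kb fb v u \<longleftrightarrow>
          (\<exists>x. classical_solution T M C K f x\<^sub>0 x\<^sub>T x \<and>
               (AE t in lebesgue_on {0<..<T}. x t = u t + v t)))) \<and>
     (\<forall>u x. x = (\<lambda>t. u t + v t) \<longrightarrow> x \<in> H2 T \<longrightarrow>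
       (\<forall>\<phi>\<in>test_functions T.
          weak_lhs T Cb Kb u \<phi> - weak_rhs T Cb Kb fb v \<phi> =
          (LINT t|lebesgue_on {0<..<T}. \<phi> t \<bullet> (matrix_exp (t *\<^sub>R Cb) *v
             (weak_deriv T (weak_deriv T x) t + Cb *v weak_deriv T x t + Kb *v x t - fb t)))))"
proof -
  note T = \<open>0 < T\<close> and C_def = assms(6) and K_def = assms(7) and fb_def = assms(8)
  note inv = positive_definite_matrix_inv[OF assms(4)]
  have eq: "M *v a + C *v b + K *v c = f t \<longleftrightarrow> a + Cb *v b + Kb *v c = fb t" for a b c t
  proof -
    have "matrix_inv M *v (M *v a + C *v b + K *v c) = a + Cb *v b + Kb *v c"
      by (simp add: C_def K_def matrix_vector_right_distrib matrix_vector_mul_assoc inv)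
    \<comment> \<open>\<open>M\<close> is a left inverse of \<open>matrix_inv M\<close>, so the
      normalization is injective and loses nothing.\<close>
    moreover have "y = z \<longleftrightarrow> matrix_inv M *v y = matrix_inv M *v z" for y z
      by (metis inv(2) matrix_vector_mul_assoc matrix_vector_mul_lid)
    ultimately show ?thesis by (metis fb_def)
  qed
  have fb: "fb \<in> L2 T"
    unfolding fb_def using assms(15) by (intro L2_matrix_vector_mult continuous_on_const)
  obtain v' where v': "continuous_on {0..T} v'"
    "\<And>t. t \<in> {0..T} \<Longrightarrow> (v has_vector_derivative v' t) (at t within {0..T})"
    using boundary_lift_C1[OF assms(10,11)] unfolding assms(14) by blast
  have ends: "v 0 = x\<^sub>0" "v T = x\<^sub>T"
    unfolding assms(14) using boundary_lift_values[OF T assms(12,13)] by auto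
  note weak = weak_solution_iff[OF T v' fb, of Cb Kb, unfolded ends]
  have strong: "weak_solution T Cb Kb fb v u \<longleftrightarrow>
      strong_solution T M C K f x\<^sub>0 x\<^sub>T (\<lambda>t. u t + v t)" for u
    using weak[of u] strong_solution_iff[where f = f and fb = fb and Cb = Cb and Kb = Kb, OF T eq]
    by simp
  have classical: "weak_solution T Cb Kb fb v u \<longleftrightarrow>
      (\<exists>x. classical_solution T M C K f x\<^sub>0 x\<^sub>T x \<and> (AE t in lebesgue_on {0<..<T}. x t = u t + v t))"
    if "continuous_on {0..T} f" for u
  proof -
    have "continuous_on {0..T} fb"
      unfolding fb_def using that by (intro continuous_intros)
    from classical_solution_iff[where f = f and fb = fb and Cb = Cb and Kb = Kb
        and x = "\<lambda>t. u t + v t", OF T this eq]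
    show ?thesis using weak[of u] by simp
  qed
  have residual: "weak_lhs T Cb Kb u \<phi> - weak_rhs T Cb Kb fb v \<phi> =
      (LINT t|lebesgue_on {0<..<T}. \<phi> t \<bullet> (matrix_exp (t *\<^sub>R Cb) *v
         (weak_deriv T (weak_deriv T x) t + Cb *v weak_deriv T x t + Kb *v x t - fb t)))"
    if x: "x = (\<lambda>t. u t + v t)" "x \<in> H2 T" and \<phi>: "\<phi> \<in> test_functions T" for u x \<phi>
  proof -
    let ?E = "\<lambda>t. matrix_exp (t *\<^sub>R Cb)"
    let ?x' = "weak_deriv T x"
    let ?x'' = "weak_deriv T ?x'"
    have x_L2: "x \<in> L2 T" "has_weak_derivative T x ?x'" "?x' \<in> L2 T"
      "has_weak_derivative T ?x' ?x''" "?x'' \<in> L2 T"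
    \<comment> \<open>The chosen second derivative inherits square integrability from the
      \<open>h\<close> that \<open>H1\<close> provides, with which it agrees almost
      everywhere.\<close>
    proof -
      obtain g h where gh: "x \<in> L2 T" "has_weak_derivative T x g" "?x' \<in> L2 T" "h \<in> L2 T"
        "has_weak_derivative T ?x' h"
        using x(2) by (auto simp: H2_def H1_def)
      note x' = weak_deriv_AE_eq[OF T gh(2)] and x'' = weak_deriv_AE_eq[OF T gh(5)]
      from gh x'(1) x''(1,3) show "x \<in> L2 T" "has_weak_derivative T x ?x'" "?x' \<in> L2 T"
        "has_weak_derivative T ?x' ?x''" "?x'' \<in> L2 T"
        by (auto intro: L2_cong_AE)
    qed
    have L2: "(\<lambda>t. Cb *v ?x' t + ?x'' t) \<in> L2 T" "(\<lambda>t. fb t - Kb *v x t) \<in> L2 T"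
      by (intro L2_add L2_diff L2_matrix_vector_mult continuous_on_const x_L2 fb)+
    have loc: "locally_integrable T (\<lambda>t. ?E t *v y t)" if "y \<in> L2 T" for y
      using that by (intro L2_locally_integrable matrix_exp_mult_L2)
    \<comment> \<open>The integration by parts: membership in \<open>H2\<close> makes E x' weakly
      differentiable, so the derivative can be taken back from \<phi>.\<close>
    have "(LINT t|lebesgue_on {0<..<T}. vector_derivative \<phi> (at t) \<bullet> (?E t *v ?x' t)) =
        - (LINT t|lebesgue_on {0<..<T}. \<phi> t \<bullet> (?E t *v (Cb *v ?x' t + ?x'' t)))"
      using has_weak_derivative_iff_vector_test_functions[OF T loc[OF x_L2(3)] loc[OF L2(1)]]
        matrix_exp_mult_derivative[OF T x_L2(4)] \<phi> by blast
    then have "weak_lhs T Cb Kb u \<phi> - weak_rhs T Cb Kb fb v \<phi> =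
        (LINT t|lebesgue_on {0<..<T}. \<phi> t \<bullet> (?E t *v (Cb *v ?x' t + ?x'' t))) -
        (LINT t|lebesgue_on {0<..<T}. \<phi> t \<bullet> (?E t *v (fb t - Kb *v x t)))"
      using weak_lhs_minus_weak_rhs[OF T \<phi> v' x(1) x_L2(1,3,2) fb, of Cb Kb] by simp
    also have "\<dots> = (LINT t|lebesgue_on {0<..<T}.
        \<phi> t \<bullet> (?E t *v (Cb *v ?x' t + ?x'' t)) - \<phi> t \<bullet> (?E t *v (fb t - Kb *v x t)))"
      by (intro Bochner_Integration.integral_diff[symmetric] integral_test_function_inner(1)[OF T \<phi>] loc L2)
    also have "\<dots> = (LINT t|lebesgue_on {0<..<T}. \<phi> t \<bullet> (?E t *v
        (?x'' t + Cb *v ?x' t + Kb *v x t - fb t)))"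
    proof (intro Bochner_Integration.integral_cong refl)
      fix t
      have "?x'' t + Cb *v ?x' t + Kb *v x t - fb t = (Cb *v ?x' t + ?x'' t) - (fb t - Kb *v x t)"
        by simp
      then show "\<phi> t \<bullet> (?E t *v (Cb *v ?x' t + ?x'' t)) - \<phi> t \<bullet> (?E t *v (fb t - Kb *v x t)) =
          \<phi> t \<bullet> (?E t *v (?x'' t + Cb *v ?x' t + Kb *v x t - fb t))"
        by (simp only: matrix_vector_mult_diff_distrib inner_diff_right)
    qed
    finally show ?thesis .
  qed
  show ?thesis using strong classical residual by blast
qed

end
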